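(* Let $f(z)=z+\sum_{n=2}^{\infty}a_nz^n\in\mathcal{C}_2$ and let $N\ge2$ be an integer. Then $$|f(z)|^2+\sum_{n=N}^{\infty}|a_nz^n|\le d(f(0),\partial f(\mathbb{D}))$$ for $|z|\le r^*_{2,N}$, where $r^*_{2,N}$ is the solution in $(0,1)$ of $$1-2r-r^2-2r^N+2r^{1+N}=0.$$ The result is sharp, i.e. for each $N\ge2$ the number $r^*_{2,N}$ cannot be replaced by any larger number such that the inequality still holds for all $f\in\mathcal{C}_2$.
   Context: $\mathbb{D}=\{z\in\mathbb{C}:|z|<1\}$; $d$ is the Euclidean distance and $\partial f(\mathbb{D})$ is the boundary of $f(\mathbb{D})$. A convex function is a univalent analytic function on $\mathbb{D}$ whose image is a convex domain. The class $\mathcal{C}_2$ consists of the analytic functions $f(z)=z+\sum_{n=2}^\infty a_nz^n$ on $\mathbb{D}$ for which there exists a convex function $g(z)=b_1z+\cdots$ with $\operatorname{Re}(b_1)>0$ such that $\operatorname{Re}\left(\frac{(zf'(z))'}{g'(z)}\right)>0$ for all $z\in\mathbb{D}$. *)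

theory Defs
  imports "HOL-Complex_Analysis.Complex_Analysis"
begin

abbreviation unit_disc :: "complex set" where
  "unit_disc \<equiv> ball 0 1"

text \<open>The image \<open>g ` unit_disc\<close> is automatically open, connected and nonempty
  (\<open>g\<close> is injective and holomorphic), so only its convexity has to be required.\<close>

definition convex_function :: "(complex \<Rightarrow> complex) \<Rightarrow> bool" where
  "convex_function g \<longleftrightarrow>
     g holomorphic_on unit_disc \<and> inj_on g unit_disc \<and> convex (g ` unit_disc)"

text \<open>The expansion \<open>f z = z + a\<^sub>2 z\<^sup>2 + \<dots>\<close> is expressed by \<open>f 0 = 0\<close> and
  \<open>deriv f 0 = 1\<close>; likewise \<open>g z = b\<^sub>1 z + \<dots>\<close> means \<open>g 0 = 0\<close> and
  \<open>b\<^sub>1 = deriv g 0\<close>.\<close>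

definition class_C2 :: "(complex \<Rightarrow> complex) set" where
  "class_C2 = {f. f holomorphic_on unit_disc \<and> f 0 = 0 \<and> deriv f 0 = 1 \<and>
     (\<exists>g. convex_function g \<and> g 0 = 0 \<and> Re (deriv g 0) > 0 \<and>
        (\<forall>z\<in>unit_disc. Re (deriv (\<lambda>w. w * deriv f w) z / deriv g z) > 0))}"

definition taylor_coeff :: "(complex \<Rightarrow> complex) \<Rightarrow> nat \<Rightarrow> complex" where
  "taylor_coeff f n = fps_nth (fps_expansion f 0) n"

text \<open>For \<open>f\<close> holomorphic on the disc and \<open>z\<close> in the disc the series below converges.
  \<open>infdist x {} = 0\<close> is not an issue either: an injective image of the disc is never the
  whole plane, and members of \<open>class_C2\<close> are univalent, so the frontier is nonempty.\<close>

definition bohr_ineq :: "nat \<Rightarrow> (complex \<Rightarrow> complex) \<Rightarrow> complex \<Rightarrow> bool" where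
  "bohr_ineq N f z \<longleftrightarrow>
     (cmod (f z))\<^sup>2 + (\<Sum>\<^sub>\<infinity>n\<in>{N..}. cmod (taylor_coeff f n * z ^ n))
       \<le> infdist (f 0) (frontier (f ` unit_disc))"

definition radius_root :: "nat \<Rightarrow> real \<Rightarrow> bool" where
  "radius_root N r \<longleftrightarrow>
     0 < r \<and> r < 1 \<and> 1 - 2 * r - r\<^sup>2 - 2 * r ^ N + 2 * r ^ (1 + N) = 0"

end

theory Submission
  imports Defs
begin

text \<open>Write \<open>(z f')' = g' p\<close> with \<open>g\<close> convex and \<open>Re p > 0\<close>. Averaging over the \<open>n\<close>-th roots of unity
  keeps a function inside a convex range and isolates its \<open>n\<close>-th coefficient, so Schwarz's lemma
  bounds the coefficients of \<open>g\<close> and \<open>p\<close>; multiplying the two series gives \<open>cmod a\<^sub>n \<le> 1\<close>. Hence the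
  left-hand side at radius \<open>r\<close> is at most \<open>(r / (1 - r))\<^sup>2 + r ^ N / (1 - r)\<close>, and \<open>r\<^sup>*\<close> is where this equals
  \<open>1 / 2\<close>.

  It remains to see that the image of \<open>f\<close> contains the disc of radius \<open>1 / 2\<close> and is not the whole plane.
  The function \<open>F = z f'\<close> is close-to-convex, and the distortion bounds for \<open>g\<close> and \<open>p\<close> give
  \<open>cmod F' \<ge> (1 - r) / (1 + r)\<^sup>3\<close>; integrating along preimages of rays gives \<open>cmod F \<ge> r / (1 + r)\<^sup>2\<close>,
  that is, \<open>cmod f' \<ge> 1 / (1 + r)\<^sup>2\<close>, and integrating once more gives the disc of radius \<open>1 / 2\<close>.
  Both integrations require univalence. For \<open>F\<close> it is the Noshiro--Warschawski argument; for \<open>f\<close>,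
  the functions \<open>f + t g\<close> with \<open>t \<ge> 0\<close> have images that expand with \<open>t\<close>, so a coincidence of two
  values at some \<open>t\<close> persists when \<open>t\<close> grows, but for large \<open>t\<close> there is none.
  Equality holds for \<open>z / (1 - z)\<close>, which maps the disc onto a half-plane.\<close>

section \<open>Coefficient bounds\<close>

lemma taylor_sums:
  assumes "f holomorphic_on unit_disc" "z \<in> unit_disc"
  shows "(\<lambda>n. taylor_coeff f n * z ^ n) sums f z"
  using holomorphic_power_series[OF assms] by (simp add: taylor_coeff_def fps_expansion_def)

lemma taylor_coeff_0: "taylor_coeff f 0 = f 0"
  by (simp add: taylor_coeff_def fps_expansion_def)

lemma has_fps_expansion_unit_disc:
  assumes "f holomorphic_on unit_disc"
  shows "f has_fps_expansion Abs_fps (taylor_coeff f)"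
proof -
  have "Abs_fps (taylor_coeff f) = fps_expansion f 0"
    by (simp add: fps_eq_iff taylor_coeff_def)
  moreover have "f has_fps_expansion fps_expansion f 0"
    by (rule has_fps_expansion_fps_expansion[OF _ _ assms]) auto
  ultimately show ?thesis by simp
qed

text \<open>The mean of \<open>F (\<omega> ^ j * z)\<close> over \<open>j < n\<close> stays in the
  convex set and kills the coefficients of index strictly between 0 and \<open>n\<close>. What is
  left beyond the constant term is divisible by \<open>z ^ n\<close>, and \<open>M\<close> is the
  quotient.\<close>

lemma roots_of_unity_average:
  assumes F: "F holomorphic_on unit_disc" and n: "n \<ge> 1"
    and F_in: "F ` unit_disc \<subseteq> \<Omega>" and cv: "convex \<Omega>"
  obtains M where "M holomorphic_on unit_disc" "M 0 = taylor_coeff F n"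
    "\<And>z. z \<in> unit_disc \<Longrightarrow> F 0 + z ^ n * M z \<in> \<Omega>"
proof -
  define \<omega> where "\<omega> = exp (2 * of_real pi * \<i> / of_nat n)"
  have w_pow: "\<omega> ^ k = exp (2 * of_real pi * \<i> * of_nat k / of_nat n)" for k
    by (simp add: \<omega>_def exp_of_nat_mult[symmetric] mult_ac)
  have w1: "\<omega> ^ n = 1"
    using n by (simp add: w_pow)
  have wne: "\<omega> ^ k \<noteq> 1" if "0 < k" "k < n" for k
    using complex_root_unity_eq_1[OF n, of k] that n unfolding w_pow
    by (auto dest: dvd_imp_le)
  have norm_w: "cmod \<omega> = 1"
    using w1 n by (metis norm_one norm_power norm_ge_zero power_eq_1_iff not_one_le_zero)
  define a where "a = taylor_coeff F"
  \<comment> \<open>These are the Taylor coefficients of the mean \<open>m\<close>. The factor is 1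
    if \<open>n\<close> divides \<open>k\<close> and 0 otherwise.\<close>
  define b where "b k = a k * ((\<Sum>j<n. (\<omega> ^ k) ^ j) / of_nat n)" for k
  define m where "m z = (\<Sum>j<n. F (\<omega> ^ j * z)) / of_nat n" for z
  have in_disc: "\<omega> ^ j * z \<in> unit_disc" if "z \<in> unit_disc" for j z
    using that norm_w by (simp add: norm_mult norm_power)
  have m_in: "m z \<in> \<Omega>" if "z \<in> unit_disc" for z
  proof -
    have "(\<Sum>j<n. (1 / real n) *\<^sub>R F (\<omega> ^ j * z)) \<in> \<Omega>"
      using n F_in in_disc[OF that] by (intro convex_sum cv) auto
    also have "(\<Sum>j<n. (1 / real n) *\<^sub>R F (\<omega> ^ j * z)) = m z"
      by (simp add: m_def scaleR_conv_of_real sum_divide_distrib)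
    finally show ?thesis .
  qed
  have m_sums: "(\<lambda>k. b k * z ^ k) sums m z" if z: "z \<in> unit_disc" for z
  proof -
    have "(\<lambda>k. (\<Sum>j<n. a k * (\<omega> ^ j * z) ^ k)) sums (\<Sum>j<n. F (\<omega> ^ j * z))"
      unfolding a_def by (intro sums_sum taylor_sums F in_disc z)
    hence "(\<lambda>k. (\<Sum>j<n. a k * (\<omega> ^ j * z) ^ k) / of_nat n) sums m z"
      unfolding m_def by (rule sums_divide)
    moreover have "(\<Sum>j<n. a k * (\<omega> ^ j * z) ^ k) / of_nat n = b k * z ^ k" for k
      unfolding b_def by (simp add: sum_distrib_left sum_distrib_right sum_divide_distrib
          power_mult_distrib power_mult[symmetric] mult_ac)
    ultimately show ?thesis by simp
  qed
  have b0: "b k = 0" if "0 < k" "k < n" for k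
  proof -
    have "(\<Sum>j<n. (\<omega> ^ k) ^ j) = (1 - (\<omega> ^ k) ^ n) / (1 - \<omega> ^ k)"
      using wne[OF that] by (subst sum_gp_strict) auto
    also have "(\<omega> ^ k) ^ n = 1"
      by (metis w1 power_mult mult.commute power_one)
    finally show ?thesis by (simp add: b_def)
  qed
  have bn: "b n = a n"
    using n by (simp add: b_def w1)
  have b00: "b 0 = F 0"
    using n by (simp add: b_def a_def taylor_coeff_0)
  define M where "M z = (\<Sum>k. b (k + n) * z ^ k)" for z
  have M_sums: "(\<lambda>k. b (k + n) * z ^ k) sums M z"
    and m_eq: "m z = F 0 + z ^ n * M z" if z: "z \<in> unit_disc" for z
  proof -
    have "(\<lambda>k. b (k + n) * z ^ (k + n)) sums (m z - (\<Sum>k<n. b k * z ^ k))"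
      using m_sums[OF z] by (subst sums_iff_shift')
    also have "(\<Sum>k<n. b k * z ^ k) = (\<Sum>k\<in>{0}. b k * z ^ k)"
      using n b0 by (intro sum.mono_neutral_right) auto
    finally have *: "(\<lambda>k. b (k + n) * z ^ (k + n)) sums (m z - F 0)"
      by (simp add: b00)
    have summ: "summable (\<lambda>k. b (k + n) * z ^ k)"
    proof (cases "z = 0")
      case True
      then show ?thesis by (intro summable_finite[of "{0}"]) auto
    next
      case False
      have "(\<lambda>k. b (k + n) * z ^ (k + n) / z ^ n) sums ((m z - F 0) / z ^ n)"
        by (rule sums_divide[OF *])
      then show ?thesis using False by (simp add: power_add sums_iff)
    qed
    then show "(\<lambda>k. b (k + n) * z ^ k) sums M z"
      unfolding M_def by (rule summable_sums)
    then have "(\<lambda>k. z ^ n * (b (k + n) * z ^ k)) sums (z ^ n * M z)"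
      by (rule sums_mult)
    also have "(\<lambda>k. z ^ n * (b (k + n) * z ^ k)) = (\<lambda>k. b (k + n) * z ^ (k + n))"
      by (simp add: power_add mult_ac)
    finally have "m z - F 0 = z ^ n * M z"
      using * sums_unique2 by blast
    then show "m z = F 0 + z ^ n * M z"
      by (simp add: algebra_simps)
  qed
  show ?thesis
  proof
    show "M holomorphic_on unit_disc"
      by (rule power_series_holomorphic[where a = "\<lambda>k. b (k + n)"]) (use M_sums in auto)
    show "M 0 = taylor_coeff F n"
      using bn by (simp add: M_def powser_zero[of "\<lambda>k. b (k + n)"] a_def)
    show "F 0 + z ^ n * M z \<in> \<Omega>" if "z \<in> unit_disc" for z
      using m_in[OF that] m_eq[OF that] by simp
  qed
qed

text \<open>Composing \<open>T\<close> with the averaged \<open>F\<close> gives a function of the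
  form \<open>z ^ n * \<Psi> z\<close> with values in the disc. As in Schwarz's lemma,
  \<open>cmod (\<Psi> 0) \<le> 1\<close>, and \<open>\<Psi> 0\<close> is the product of the
  \<open>n\<close>-th coefficient and the derivative of \<open>T\<close> at
  \<open>F 0\<close>.\<close>

lemma coeff_bound_if_convex_range:
  assumes F: "F holomorphic_on unit_disc" and n: "n \<ge> 1"
    and F_in: "F ` unit_disc \<subseteq> \<Omega>" and \<Omega>: "convex \<Omega>" "open \<Omega>"
    and T: "T holomorphic_on \<Omega>" and T_in: "T ` \<Omega> \<subseteq> unit_disc" and T0: "T (F 0) = 0"
  shows "cmod (deriv T (F 0)) * cmod (taylor_coeff F n) \<le> 1"
proof -
  obtain M where M: "M holomorphic_on unit_disc" "M 0 = taylor_coeff F n"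
    and M_in: "\<And>z. z \<in> unit_disc \<Longrightarrow> F 0 + z ^ n * M z \<in> \<Omega>"
    using roots_of_unity_average[OF F n F_in \<Omega>(1)] by metis
  \<comment> \<open>\<open>T\<close> vanishes at \<open>F 0\<close>, so this quotient has a
    removable singularity there; it lets \<open>z ^ n\<close> be factored out of
    \<open>T (F 0 + z ^ n * M z)\<close>.\<close>
  define T1 where "T1 w = (if w = F 0 then deriv T (F 0) else T w / (w - F 0))" for w
  have T1: "T1 holomorphic_on \<Omega>"
    by (rule pole_theorem_open_0[OF T \<Omega>(2), of "F 0"]) (auto simp: T1_def T0)
  have T_eq: "T w = (w - F 0) * T1 w" for w
    by (simp add: T1_def T0)
  define \<Psi> where "\<Psi> z = M z * T1 (F 0 + z ^ n * M z)" for z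
  have hol: "\<Psi> holomorphic_on unit_disc"
  proof -
    have "(T1 \<circ> (\<lambda>z. F 0 + z ^ n * M z)) holomorphic_on unit_disc"
      by (rule holomorphic_on_compose_gen[OF _ T1]) (use M M_in in \<open>auto intro!: holomorphic_intros\<close>)
    then show ?thesis
      unfolding \<Psi>_def o_def using M by (intro holomorphic_intros)
  qed
  have le: "cmod (z ^ n * \<Psi> z) < 1" if "z \<in> unit_disc" for z
  proof -
    have "z ^ n * \<Psi> z = T (F 0 + z ^ n * M z)"
      by (simp add: T_eq \<Psi>_def)
    then show ?thesis using M_in[OF that] T_in by auto
  qed
  \<comment> \<open>Maximum modulus principle on the circle of radius \<open>r\<close>; afterwards
    \<open>r\<close> tends to 1.\<close>
  have bound: "cmod (\<Psi> 0) \<le> 1 / r ^ n" if r: "0 < r" "r < 1" for r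
  proof (rule maximum_modulus_frontier[of \<Psi> "cball 0 r"])
    show "\<Psi> holomorphic_on interior (cball 0 r)" "continuous_on (closure (cball 0 r)) \<Psi>"
      using r by (auto intro!: holomorphic_on_subset[OF hol]
          holomorphic_on_imp_continuous_on[OF holomorphic_on_subset[OF hol]])
    show "cmod (\<Psi> z) \<le> 1 / r ^ n" if "z \<in> frontier (cball 0 r)" for z
    proof -
      have z: "cmod z = r" using that r by simp
      then show ?thesis
        using le[of z] r by (simp add: norm_mult norm_power field_simps)
    qed
  qed (use r in auto)
  have "cmod (\<Psi> 0) \<le> 1"
  proof (rule tendsto_lowerbound[of "\<lambda>r. 1 / r ^ n" _ "at_left (1::real)"])
    have "((\<lambda>r. 1 / r ^ n) \<longlongrightarrow> 1 / 1 ^ n) (at_left (1::real))"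
      by (intro tendsto_intros) auto
    then show "((\<lambda>r. 1 / r ^ n) \<longlongrightarrow> 1) (at_left (1::real))" by simp
    show "\<forall>\<^sub>F r in at_left 1. cmod (\<Psi> 0) \<le> 1 / r ^ n"
      by (rule eventually_at_leftI[of 0]) (use bound in auto)
  qed auto
  moreover have "\<Psi> 0 = taylor_coeff F n * deriv T (F 0)"
    using n by (simp add: \<Psi>_def M(2) T1_def)
  ultimately show ?thesis by (simp add: norm_mult mult.commute)
qed

section \<open>Convex functions and functions with positive real part\<close>

lemma convex_function_inverse:
  assumes "convex_function g"
  obtains h where "h holomorphic_on g ` unit_disc"
    "\<And>z. z \<in> unit_disc \<Longrightarrow> h (g z) = z" "\<And>z. z \<in> unit_disc \<Longrightarrow> deriv g z * deriv h (g z) = 1"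
    "open (g ` unit_disc)"
proof -
  have g: "g holomorphic_on unit_disc" "inj_on g unit_disc"
    using assms by (auto simp: convex_function_def)
  show ?thesis
    using holomorphic_has_inverse[OF g(1) _ g(2)] open_mapping_thm3[OF g(1) _ g(2)] that
    by (metis open_ball)
qed

lemma convex_function_deriv_nonzero:
  assumes "convex_function g" "z \<in> unit_disc"
  shows "deriv g z \<noteq> 0"
proof -
  obtain h where "\<And>z. z \<in> unit_disc \<Longrightarrow> deriv g z * deriv h (g z) = 1"
    using convex_function_inverse[OF assms(1)] by metis
  then show ?thesis
    using assms(2) by fastforce
qed

text \<open>The general bound with \<open>T\<close> the inverse of \<open>g\<close>, whose
  derivative at \<open>g 0\<close> is the reciprocal of \<open>deriv g 0\<close>.\<close>

lemma convex_function_coeff_bound: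
  assumes g: "convex_function g" and n: "n \<ge> 1"
  shows "cmod (taylor_coeff g n) \<le> cmod (deriv g 0)"
proof -
  obtain h where h: "h holomorphic_on g ` unit_disc"
    "\<And>z. z \<in> unit_disc \<Longrightarrow> h (g z) = z" "\<And>z. z \<in> unit_disc \<Longrightarrow> deriv g z * deriv h (g z) = 1"
    "open (g ` unit_disc)"
    using convex_function_inverse[OF g] by metis
  have "cmod (deriv h (g 0)) * cmod (taylor_coeff g n) \<le> 1"
    by (rule coeff_bound_if_convex_range[of _ _ "g ` unit_disc"])
       (use g h n in \<open>auto simp: convex_function_def\<close>)
  moreover have "cmod (deriv g 0) * cmod (deriv h (g 0)) = 1"
    using h(3)[of 0] by (simp flip: norm_mult)
  ultimately show ?thesis
    using convex_function_deriv_nonzero[OF g, of 0]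
    by (metis (no_types, opaque_lifting) mult.assoc mult.commute mult.right_neutral mult_left_mono norm_ge_zero)
qed

text \<open>The quotient is the Cayley transform of the right half-plane onto the disc that sends
  \<open>c\<close> to 0.\<close>

lemma norm_cayley_less:
  assumes "Re w > 0" "Re c > 0"
  shows "w + cnj c \<noteq> 0" "cmod ((w - c) / (w + cnj c)) < 1"
proof -
  have "Re (w + cnj c) \<noteq> 0" using assms by simp
  then show 1: "w + cnj c \<noteq> 0" by (metis zero_complex.sel(1))
  have "(cmod (w + cnj c))\<^sup>2 - (cmod (w - c))\<^sup>2 = 4 * Re w * Re c"
    unfolding cmod_power2 by (simp add: power2_eq_square algebra_simps)
  then have "(cmod (w - c))\<^sup>2 < (cmod (w + cnj c))\<^sup>2"
    using assms by (smt (verit) mult_pos_pos)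
  then have "cmod (w - c) < cmod (w + cnj c)"
    by (rule power_less_imp_less_base) simp
  then show "cmod ((w - c) / (w + cnj c)) < 1"
    using 1 by (simp add: norm_divide)
qed

text \<open>The general bound with the right half-plane as range and its Cayley transform as
  \<open>T\<close>, whose derivative at \<open>p 0\<close> is
  \<open>1 / (2 * Re (p 0))\<close>.\<close>

lemma caratheodory_coeff_bound:
  assumes p: "p holomorphic_on unit_disc" and pos: "\<And>z. z \<in> unit_disc \<Longrightarrow> Re (p z) > 0"
    and n: "n \<ge> 1"
  shows "cmod (taylor_coeff p n) \<le> 2 * Re (p 0)"
proof -
  let ?\<Omega> = "{w. Re w > 0}" and ?T = "\<lambda>w. (w - p 0) / (w + cnj (p 0))"
  have p0: "Re (p 0) > 0" using pos by simp
  have nz: "p 0 + cnj (p 0) \<noteq> 0" using norm_cayley_less(1)[OF p0 p0] .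
  have "cmod (deriv ?T (p 0)) * cmod (taylor_coeff p n) \<le> 1"
  proof (rule coeff_bound_if_convex_range[OF p n, of ?\<Omega>])
    show "?T holomorphic_on ?\<Omega>"
      using norm_cayley_less(1)[OF _ p0] by (intro holomorphic_intros) auto
    show "?T ` ?\<Omega> \<subseteq> unit_disc" using norm_cayley_less(2)[OF _ p0] by auto
  qed (auto simp: pos convex_halfspace_Re_gt open_halfspace_Re_gt)
  moreover have "(?T has_field_derivative 1 / (p 0 + cnj (p 0))) (at (p 0))"
    using nz by (auto intro!: derivative_eq_intros)
  then have "deriv ?T (p 0) = 1 / (p 0 + cnj (p 0))"
    by (rule DERIV_imp_deriv)
  moreover have "p 0 + cnj (p 0) = of_real (2 * Re (p 0))"
    by (simp add: complex_eq_iff)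
  ultimately show ?thesis
    using p0 by (simp add: norm_divide norm_mult divide_le_eq field_simps)
qed

lemma norm_le_geometric:
  assumes F: "F holomorphic_on unit_disc" and bd: "\<And>n. n \<ge> 1 \<Longrightarrow> cmod (taylor_coeff F n) \<le> M"
    and z: "z \<in> unit_disc"
  shows "cmod (F z - F 0) \<le> M * cmod z / (1 - cmod z)"
proof -
  let ?r = "cmod z"
  have r: "?r < 1" using z by simp
  have s: "(\<lambda>n. taylor_coeff F (Suc n) * z ^ Suc n) sums (F z - F 0)"
    using taylor_sums[OF F z] by (subst sums_Suc_iff) (simp add: taylor_coeff_0)
  have t: "(\<lambda>n. M * ?r * ?r ^ n) sums (M * ?r * (1 / (1 - ?r)))"
    using r by (intro sums_mult geometric_sums) simp
  have "norm (\<Sum>n. taylor_coeff F (Suc n) * z ^ Suc n) \<le> (\<Sum>n. M * ?r * ?r ^ n)"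
  proof (rule norm_suminf_le)
    show "norm (taylor_coeff F (Suc n) * z ^ Suc n) \<le> M * ?r * ?r ^ n" for n
      using mult_right_mono[OF bd[of "Suc n"], of "?r ^ Suc n"]
      by (simp add: norm_mult norm_power mult_ac)
  qed (use t in \<open>simp add: sums_iff\<close>)
  then show ?thesis using s t by (simp add: sums_iff)
qed

section \<open>The coefficients of members of the class\<close>

lemma class_C2E:
  assumes "f \<in> class_C2"
  obtains g p where "f holomorphic_on unit_disc" "f 0 = 0" "deriv f 0 = 1"
    "convex_function g" "g 0 = 0" "p holomorphic_on unit_disc"
    "\<And>z. z \<in> unit_disc \<Longrightarrow> Re (p z) > 0"
    "\<And>z. z \<in> unit_disc \<Longrightarrow> ((\<lambda>w. w * deriv f w) has_field_derivative deriv g z * p z) (at z)"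
    "deriv g 0 * p 0 = 1"
proof -
  obtain g where f: "f holomorphic_on unit_disc" "f 0 = 0" "deriv f 0 = 1"
    and g: "convex_function g" "g 0 = 0"
    and pos: "\<And>z. z \<in> unit_disc \<Longrightarrow> Re (deriv (\<lambda>w. w * deriv f w) z / deriv g z) > 0"
    using assms by (auto simp: class_C2_def)
  define F where "F = (\<lambda>w. w * deriv f w)"
  have f': "deriv f holomorphic_on unit_disc" by (rule holomorphic_deriv[OF f(1)]) simp
  then have F: "F holomorphic_on unit_disc" unfolding F_def by (intro holomorphic_on_mult holomorphic_on_ident f')
  note nz = convex_function_deriv_nonzero[OF g(1)]
  define p where "p = (\<lambda>z. deriv F z / deriv g z)"
  have eq: "deriv F z = deriv g z * p z" if "z \<in> unit_disc" for z
    using nz[OF that] by (simp add: p_def)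
  show ?thesis
  proof (rule that[OF f g])
    show "p holomorphic_on unit_disc"
      unfolding p_def using nz g F
      by (auto intro!: holomorphic_intros holomorphic_deriv simp: convex_function_def)
    show "Re (p z) > 0" if "z \<in> unit_disc" for z
      using pos[OF that] by (simp add: p_def F_def)
    show der: "((\<lambda>w. w * deriv f w) has_field_derivative deriv g z * p z) (at z)"
      if "z \<in> unit_disc" for z
      using holomorphic_derivI[OF F _ that] eq[OF that] by (simp add: F_def)
    \<comment> \<open>At 0 the derivative of \<open>w * deriv f w\<close> is
      \<open>deriv f 0 = 1\<close>, which normalises the product
      \<open>deriv g 0 * p 0\<close>.\<close>
    have "((\<lambda>w. w * deriv f w) has_field_derivative deriv f 0) (at 0)"
      using holomorphic_derivI[OF f', of 0] by (auto intro!: derivative_eq_intros)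
    then show "deriv g 0 * p 0 = 1"
      using der[of 0] DERIV_unique f(3) by fastforce
  qed
qed

text \<open>Comparing coefficients in \<open>(z f')' = g' p\<close> writes \<open>n\<^sup>2\<close>
  times the \<open>n\<close>-th coefficient of \<open>f\<close> as a convolution. The bounds for
  \<open>g\<close> and \<open>p\<close>, with \<open>deriv g 0 * p 0 = 1\<close>, estimate it by
  \<open>n + 2 * (1 + ... + (n - 1))\<close>, which is \<open>n\<^sup>2\<close>.\<close>

lemma class_C2_coeff_bound:
  assumes f: "f \<in> class_C2"
  shows "cmod (taylor_coeff f n) \<le> 1"
proof (cases n)
  case 0
  then show ?thesis using f by (auto simp: taylor_coeff_0 class_C2_def)
next
  case (Suc m)
  obtain g p where fh: "f holomorphic_on unit_disc" "f 0 = 0" "deriv f 0 = 1"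
    and g: "convex_function g" "g 0 = 0" and p: "p holomorphic_on unit_disc"
    "\<And>z. z \<in> unit_disc \<Longrightarrow> Re (p z) > 0"
    and der: "\<And>z. z \<in> unit_disc \<Longrightarrow> ((\<lambda>w. w * deriv f w) has_field_derivative deriv g z * p z) (at z)"
    and p0: "deriv g 0 * p 0 = 1"
    by (rule class_C2E[OF f], rule that)
  have gh: "g holomorphic_on unit_disc" using g(1) by (simp add: convex_function_def)
  let ?f = "Abs_fps (taylor_coeff f)" and ?g = "Abs_fps (taylor_coeff g)"
    and ?p = "Abs_fps (taylor_coeff p)"
  have L: "deriv (\<lambda>w. w * deriv f w) has_fps_expansion fps_deriv (fps_X * fps_deriv ?f)"
    by (intro has_fps_expansion_deriv has_fps_expansion_mult has_fps_expansion_fps_X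
        has_fps_expansion_unit_disc fh(1))
  have R: "(\<lambda>z. deriv g z * p z) has_fps_expansion fps_deriv ?g * ?p"
    by (intro has_fps_expansion_deriv has_fps_expansion_mult has_fps_expansion_unit_disc gh p(1))
  have "eventually (\<lambda>z::complex. z \<in> unit_disc) (nhds 0)"
    by (rule eventually_nhds_in_open) auto
  then have ev: "eventually (\<lambda>z. deriv g z * p z = deriv (\<lambda>w. w * deriv f w) z) (nhds 0)"
    by (rule eventually_mono) (rule DERIV_imp_deriv[OF der, symmetric])
  have "deriv (\<lambda>w. w * deriv f w) has_fps_expansion fps_deriv ?g * ?p"
    by (rule iffD1[OF has_fps_expansion_cong[OF ev refl] R])
  then have "fps_deriv ?g * ?p = fps_deriv (fps_X * fps_deriv ?f)"
    using L by (rule fps_expansion_unique_complex)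
  moreover have "fps_nth (fps_deriv (fps_X * fps_deriv ?f)) m = of_nat n ^ 2 * taylor_coeff f n"
    by (subst fps_deriv_nth) (simp add: Suc power2_eq_square)
  ultimately have eq: "of_nat n ^ 2 * taylor_coeff f n =
      (\<Sum>i=0..m. of_nat (Suc i) * taylor_coeff g (Suc i) * taylor_coeff p (m - i))"
    by (metis (no_types, lifting) fps_mult_nth fps_deriv_nth fps_nth_Abs_fps Suc_eq_plus1 sum.cong)
  have b1p0: "cmod (deriv g 0) * cmod (p 0) = 1"
    using p0 by (simp flip: norm_mult)
  \<comment> \<open>The term \<open>i = m\<close> contains the constant coefficient of
    \<open>p\<close>, for which the factor 2 of the other coefficients is absent.\<close>
  have term_le: "cmod (of_nat (Suc i) * taylor_coeff g (Suc i) * taylor_coeff p (m - i))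
      \<le> (if i = m then real n else 2 * real (Suc i))" if "i \<le> m" for i
  proof -
    let ?P = "if i = m then cmod (p 0) else 2 * cmod (p 0)"
    have "cmod (taylor_coeff p (m - i)) \<le> ?P"
    proof (cases "i = m")
      case False
      then have "cmod (taylor_coeff p (m - i)) \<le> 2 * Re (p 0)"
        using that by (intro caratheodory_coeff_bound p) auto
      then show ?thesis using False complex_Re_le_cmod[of "p 0"] by simp
    qed (simp add: taylor_coeff_0)
    then have "cmod (taylor_coeff g (Suc i)) * cmod (taylor_coeff p (m - i)) \<le> cmod (deriv g 0) * ?P"
      by (intro mult_mono convex_function_coeff_bound g(1)) auto
    also have "\<dots> = (if i = m then 1 else 2)" using b1p0 by auto
    finally have "real (Suc i) * (cmod (taylor_coeff g (Suc i)) * cmod (taylor_coeff p (m - i)))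
        \<le> real (Suc i) * (if i = m then 1 else 2)"
      by (intro mult_left_mono) auto
    moreover have "cmod (of_nat (Suc i) * taylor_coeff g (Suc i) * taylor_coeff p (m - i))
        = real (Suc i) * (cmod (taylor_coeff g (Suc i)) * cmod (taylor_coeff p (m - i)))"
      by (simp add: norm_mult del: of_nat_Suc)
    ultimately show ?thesis
      using Suc by (auto simp del: of_nat_Suc split: if_splits)
  qed
  have "real n ^ 2 * cmod (taylor_coeff f n) = cmod (of_nat n ^ 2 * taylor_coeff f n)"
    by (simp add: norm_mult norm_power)
  also have "\<dots> \<le> (\<Sum>i=0..m. (if i = m then real n else 2 * real (Suc i)))"
    unfolding eq by (rule sum_norm_le) (use term_le in auto)
  also have "\<dots> = real n + (\<Sum>i<m. 2 * real (Suc i))"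
    by (simp add: atLeast0AtMost lessThan_Suc_atMost[symmetric])
  also have "(\<Sum>i<m. 2 * real (Suc i)) = real m * real n"
    unfolding Suc by (induction m) (auto simp: algebra_simps)
  also have "real n + real m * real n = real n ^ 2"
    by (simp add: Suc power2_eq_square algebra_simps)
  finally show ?thesis
    using Suc by (simp add: mult_le_cancel_left1)
qed

section \<open>Growth and distortion\<close>

lemma has_vector_derivative_along_ray:
  assumes "(h has_field_derivative h') (at (of_real t * w))"
  shows "((\<lambda>s. h (of_real s * w)) has_vector_derivative w * h') (at t)"
proof -
  have "((\<lambda>s. of_real s * w) has_vector_derivative w) (at t)"
    by (auto intro!: derivative_eq_intros simp: has_vector_derivative_def scaleR_conv_of_real)
  from field_vector_diff_chain_at[OF this, of h h'] assms show ?thesis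
    by (simp add: o_def)
qed

lemma norm_along_ray_derivative:
  assumes "(h has_field_derivative h') (at (of_real t * w))" "h (of_real t * w) \<noteq> 0"
  shows "((\<lambda>s. cmod (h (of_real s * w))) has_real_derivative
    inner (w * h') (sgn (h (of_real t * w)))) (at t)"
proof -
  let ?c = "\<lambda>s. h (of_real s * w)"
  have "(?c has_derivative (\<lambda>s. s *\<^sub>R (w * h'))) (at t)"
    using has_vector_derivative_along_ray[OF assms(1)] by (simp add: has_vector_derivative_def)
  from has_derivative_compose[OF this has_derivative_norm[OF assms(2)]]
  have "((\<lambda>s. cmod (?c s)) has_derivative (\<lambda>s. s * inner (w * h') (sgn (?c t)))) (at t)"
    by simp
  then show ?thesis
    by (simp add: has_field_derivative_def mult.commute[of _ "inner _ _"])
qed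

lemma norm_along_ray_derivative_le:
  assumes "(h has_field_derivative h') (at (of_real t * w))" "h (of_real t * w) \<noteq> 0"
  obtains D where "((\<lambda>s. cmod (h (of_real s * w))) has_real_derivative D) (at t)"
    "D \<le> cmod w * cmod h'"
proof -
  have "inner (w * h') (sgn (h (of_real t * w))) \<le> cmod (w * h') * cmod (sgn (h (of_real t * w)))"
    using Cauchy_Schwarz_ineq2[of "w * h'" "sgn (h (of_real t * w))"] by simp
  then have "inner (w * h') (sgn (h (of_real t * w))) \<le> cmod w * cmod h'"
    using assms(2) by (simp add: norm_sgn norm_mult)
  with norm_along_ray_derivative[OF assms] show ?thesis by (rule that)
qed

text \<open>Precomposing with the disc automorphism that takes 0 to \<open>a\<close> and
  \<open>- a\<close> to 0 keeps the image, so bounds at the origin can be transported to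
  \<open>a\<close>.\<close>

lemma convex_function_moebius:
  assumes g: "convex_function g" and a: "a \<in> unit_disc"
  obtains G where "convex_function G" "G 0 = g a" "G (- a) = g 0"
    "deriv G 0 = deriv g a * of_real (1 - (cmod a)\<^sup>2)"
proof -
  define M where "M = Moebius_function 0 (- a)"
  define G where "G = g \<circ> M"
  have a1: "cmod a < 1" using a by simp
  have gh: "g holomorphic_on unit_disc" "inj_on g unit_disc" "convex (g ` unit_disc)"
    using g by (auto simp: convex_function_def)
  have M_in: "M z \<in> unit_disc" if "z \<in> unit_disc" for z
    using Moebius_function_norm_lt_1[of "- a" z 0] a1 that by (simp add: M_def)
  have M_inv: "Moebius_function 0 a (M z) = z" if "z \<in> unit_disc" for z
    using Moebius_function_compose[of a "- a" z] a1 that by (simp add: M_def)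
  have M_surj: "\<exists>y\<in>unit_disc. M y = z" if "z \<in> unit_disc" for z
    using Moebius_function_compose[of "- a" a z] Moebius_function_norm_lt_1[of a z 0] a1 that
    by (auto simp: M_def intro!: bexI[of _ "Moebius_function 0 a z"])
  have M_hol: "M holomorphic_on unit_disc"
    unfolding M_def using a1 by (intro Moebius_function_holomorphic) simp
  have img: "M ` unit_disc = unit_disc"
    using M_in M_surj by force
  have "inj_on M unit_disc"
    using M_inv by (metis inj_onI)
  then have "convex_function G"
    unfolding convex_function_def G_def
    using gh M_hol img
    by (intro conjI holomorphic_on_compose comp_inj_on) (simp_all add: image_comp[symmetric] del: o_apply)
  moreover have M0: "M 0 = a" and Ma: "M (- a) = 0"
    by (simp_all add: M_def Moebius_function_def)
  then have "G 0 = g a" "G (- a) = g 0" by (simp_all add: G_def)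
  moreover have "(M has_field_derivative of_real (1 - (cmod a)\<^sup>2)) (at 0)"
  proof -
    have "M = (\<lambda>z. (z + a) / (1 + cnj a * z))"
      by (simp add: M_def Moebius_function_def fun_eq_iff)
    moreover have "of_real (1 - (cmod a)\<^sup>2) = 1 - a * cnj a"
      by (simp only: of_real_diff of_real_1 complex_norm_square)
    ultimately show ?thesis
      by (auto intro!: derivative_eq_intros)
  qed
  then have "deriv G 0 = deriv g a * of_real (1 - (cmod a)\<^sup>2)"
    unfolding G_def using holomorphic_derivI[OF gh(1) _ a] M0
    by (intro DERIV_imp_deriv DERIV_chain) auto
  ultimately show ?thesis by (rule that)
qed

text \<open>The coefficients of the transported function \<open>G\<close> are at most
  \<open>cmod (deriv G 0)\<close>, so summing a geometric series at \<open>- a\<close> bounds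
  \<open>cmod (g 0 - g a)\<close>. The factor \<open>1 - (cmod a)\<^sup>2\<close> of
  \<open>deriv G 0\<close> cancels the denominator \<open>1 - cmod a\<close>.\<close>

lemma convex_function_norm_le_deriv:
  assumes g: "convex_function g" "g 0 = 0" and a: "a \<in> unit_disc"
  shows "cmod (g a) \<le> cmod a * (1 + cmod a) * cmod (deriv g a)"
proof -
  obtain G where G: "convex_function G" "G 0 = g a" "G (- a) = g 0"
    "deriv G 0 = deriv g a * of_real (1 - (cmod a)\<^sup>2)"
    using convex_function_moebius[OF g(1) a] by metis
  let ?r = "cmod a"
  have r: "?r < 1" using a by simp
  have "?r\<^sup>2 \<le> 1" using r by (simp add: power_le_one)
  have "cmod (G (- a) - G 0) \<le> cmod (deriv G 0) * cmod (- a) / (1 - cmod (- a))"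
    using G(1) a by (intro norm_le_geometric convex_function_coeff_bound) (auto simp: convex_function_def)
  also have "cmod (deriv G 0) = cmod (deriv g a) * \<bar>1 - ?r\<^sup>2\<bar>"
    unfolding G(4) norm_mult norm_of_real ..
  also have "\<bar>1 - ?r\<^sup>2\<bar> = (1 - ?r) * (1 + ?r)"
    using \<open>?r\<^sup>2 \<le> 1\<close> by (simp add: power2_eq_square algebra_simps)
  also have "cmod (deriv g a) * ((1 - ?r) * (1 + ?r)) * cmod (- a) / (1 - cmod (- a))
      = ?r * (1 + ?r) * cmod (deriv g a)"
    using r by (subst nonzero_divide_eq_eq) (auto simp: mult_ac)
  finally show ?thesis using G g by simp
qed

text \<open>With \<open>u t = cmod (g\<inverse> (t * g a))\<close>, the previous lemma says \<open>t u' \<le> u (1 + u)\<close>, that is,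
  \<open>t / u + t\<close> is nondecreasing; compare \<open>t = 1\<close> with the limit as \<open>t\<close> tends to 0.\<close>

lemma convex_function_growth:
  assumes g: "convex_function g" "g 0 = 0" and a: "a \<in> unit_disc"
  shows "cmod (deriv g 0) * cmod a \<le> cmod (g a) * (1 + cmod a)"
proof (cases "a = 0")
  case True
  then show ?thesis using g by simp
next
  case False
  obtain h where h: "h holomorphic_on g ` unit_disc"
    "\<And>z. z \<in> unit_disc \<Longrightarrow> h (g z) = z" "\<And>z. z \<in> unit_disc \<Longrightarrow> deriv g z * deriv h (g z) = 1"
    "open (g ` unit_disc)"
    using convex_function_inverse[OF g(1)] by metis
  define w where "w = g a"
  have cv: "convex (g ` unit_disc)" using g by (simp add: convex_function_def)
  have h0: "h 0 = 0" using h(2)[of 0] g(2) by simp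
  have hw: "h w = a" using h(2)[OF a] by (simp add: w_def)
  have w0: "w \<noteq> 0" using False hw h0 by auto
  have in0: "0 \<in> g ` unit_disc" using g(2) by force
  have inw: "w \<in> g ` unit_disc" using a by (auto simp: w_def)
  have in\<Omega>: "of_real t * w \<in> g ` unit_disc" if "0 \<le> t" "t \<le> 1" for t
    using convexD_alt[OF cv in0 inw that] by (simp add: scaleR_conv_of_real)
  define u where "u t = cmod (h (of_real t * w))" for t
  have u_pos: "u t > 0" if t: "0 < t" "t \<le> 1" for t
  proof -
    obtain z where z: "z \<in> unit_disc" "of_real t * w = g z" using in\<Omega>[of t] t by auto
    have "z \<noteq> 0" using z g(2) t w0 by auto
    then show ?thesis using z h(2) by (simp add: u_def)
  qed
  have u_der: "\<exists>D. (u has_real_derivative D) (at t) \<and> t * D \<le> u t * (1 + u t)"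
    if t: "0 < t" "t \<le> 1" for t
  proof -
    obtain z where z: "z \<in> unit_disc" "of_real t * w = g z" using in\<Omega>[of t] t by auto
    have "(h has_field_derivative deriv h (of_real t * w)) (at (of_real t * w))"
      using holomorphic_derivI[OF h(1) h(4) in\<Omega>[of t]] t by simp
    moreover have "h (of_real t * w) \<noteq> 0" using u_pos[OF t] by (simp add: u_def)
    ultimately obtain D where D: "(u has_real_derivative D) (at t)"
      "D \<le> cmod w * cmod (deriv h (of_real t * w))"
      by (rule norm_along_ray_derivative_le[of h _ t w, folded u_def])
    have uz: "u t = cmod z" using z h(2) by (simp add: u_def)
    have inv: "cmod (deriv g z) * cmod (deriv h (g z)) = 1"
      using h(3)[OF z(1)] by (simp flip: norm_mult)
    have "t * cmod w = cmod (g z)" using z(2) t by (simp flip: z(2) add: norm_mult)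
    also have "\<dots> \<le> u t * (1 + u t) * cmod (deriv g z)"
      using convex_function_norm_le_deriv[OF g z(1)] uz by simp
    finally have "t * cmod w * cmod (deriv h (g z)) \<le> u t * (1 + u t) * cmod (deriv g z) * cmod (deriv h (g z))"
      by (rule mult_right_mono) simp
    also have "\<dots> = u t * (1 + u t)" using inv by (simp only: mult.assoc)
    finally have *: "t * cmod w * cmod (deriv h (g z)) \<le> u t * (1 + u t)" .
    have "t * D \<le> t * (cmod w * cmod (deriv h (g z)))"
      using D(2) t z(2) by simp
    then show ?thesis using * D(1) by (auto simp: mult.assoc)
  qed
  define V where "V t = t / u t + t" for t
  have V_mono: "V t \<le> V 1" if t: "0 < t" "t \<le> 1" for t
  proof (rule DERIV_nonneg_imp_nondecreasing[OF t(2)])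
    fix s assume s: "t \<le> s" "s \<le> 1"
    then obtain D where D: "(u has_real_derivative D) (at s)" "s * D \<le> u s * (1 + u s)"
      using u_der[of s] t by auto
    have up: "u s > 0" using u_pos[of s] s t by simp
    have "(V has_real_derivative (1 * u s - s * D) / (u s * u s) + 1) (at s)"
      unfolding V_def[abs_def] using D(1) up by (auto intro!: derivative_eq_intros)
    moreover have "(1 * u s - s * D) / (u s * u s) + 1 \<ge> 0"
      using D(2) up by (simp add: field_simps)
    ultimately show "\<exists>y. (V has_real_derivative y) (at s) \<and> 0 \<le> y" by blast
  qed
  have d0: "cmod (deriv g 0) * cmod (deriv h 0) = 1"
    using h(3)[of 0] g(2) by (simp flip: norm_mult)
  then have nz: "deriv h 0 \<noteq> 0" by auto
  \<comment> \<open>The limit of \<open>t / u t\<close> at 0 comes from the difference quotient of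
    \<open>h\<close> at 0, taken along the ray.\<close>
  have "((\<lambda>y. h y / y) \<longlongrightarrow> deriv h 0) (at 0)"
    using holomorphic_derivI[OF h(1) h(4) in0] by (simp add: has_field_derivative_iff h0)
  moreover have "filterlim (\<lambda>t. of_real t * w) (at 0) (at_right (0::real))"
  proof (rule filterlim_atI)
    have "((\<lambda>t. of_real t * w) \<longlongrightarrow> of_real 0 * w) (at_right (0::real))"
      by (intro tendsto_intros)
    then show "((\<lambda>t. of_real t * w) \<longlongrightarrow> 0) (at_right (0::real))" by simp
    show "\<forall>\<^sub>F t in at_right (0::real). of_real t * w \<noteq> 0"
      by (rule eventually_at_rightI[of 0 1]) (use w0 in auto)
  qed
  ultimately have lim: "((\<lambda>t. h (of_real t * w) / (of_real t * w)) \<longlongrightarrow> deriv h 0) (at_right (0::real))"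
    by (rule filterlim_compose)
  \<comment> \<open>For \<open>t > 0\<close> this is \<open>V t\<close>, rewritten so that the
    difference quotient appears; its limit is \<open>cmod (deriv g 0) / cmod w\<close>.\<close>
  let ?W = "\<lambda>t. inverse (cmod w * cmod (h (of_real t * w) / (of_real t * w))) + t"
  have "(?W \<longlongrightarrow> inverse (cmod w * cmod (deriv h 0)) + 0) (at_right 0)"
    using w0 nz by (intro tendsto_intros lim) auto
  moreover have "\<forall>\<^sub>F t in at_right 0. ?W t \<le> V 1"
  proof (rule eventually_at_rightI[of 0 1])
    fix t :: real assume t: "t \<in> {0<..<1}"
    then have "?W t = V t"
      using w0 by (simp add: V_def u_def norm_divide norm_mult)
    then show "?W t \<le> V 1"
      using V_mono[of t] t by simp
  qed simp
  ultimately have "inverse (cmod w * cmod (deriv h 0)) + 0 \<le> V 1"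
    by (rule tendsto_upperbound) simp
  then have "inverse (cmod w * cmod (deriv h 0)) \<le> 1 / cmod a + 1"
    by (simp add: V_def u_def hw)
  moreover have "inverse (cmod w * cmod (deriv h 0)) = cmod (deriv g 0) / cmod w"
    using d0 w0 nz by (simp add: field_simps)
  ultimately have "cmod (deriv g 0) / cmod w \<le> 1 / cmod a + 1" by (simp only:)
  then show ?thesis
    using w0 False by (simp add: w_def[symmetric] field_simps)
qed

text \<open>The growth bound followed by the bound of \<open>g a\<close> through
  \<open>deriv g a\<close>, with a common factor \<open>cmod a\<close> cancelled.\<close>

lemma convex_function_distortion:
  assumes g: "convex_function g" "g 0 = 0" and a: "a \<in> unit_disc"
  shows "cmod (deriv g 0) \<le> cmod (deriv g a) * (1 + cmod a)\<^sup>2"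
proof (cases "a = 0")
  case False
  have "cmod (deriv g 0) * cmod a \<le> cmod (g a) * (1 + cmod a)"
    by (rule convex_function_growth[OF assms])
  also have "\<dots> \<le> cmod a * (1 + cmod a) * cmod (deriv g a) * (1 + cmod a)"
    by (intro mult_right_mono convex_function_norm_le_deriv[OF assms]) simp
  finally have "cmod (deriv g 0) * cmod a \<le> (cmod (deriv g a) * (1 + cmod a)\<^sup>2) * cmod a"
    by (simp add: power2_eq_square mult_ac)
  then show ?thesis using False by simp
qed simp

text \<open>Schwarz's lemma applied to the Cayley transform \<open>\<omega>\<close> of
  \<open>p\<close> gives \<open>cmod (\<omega> z) \<le> cmod z\<close>. Solving for \<open>p\<close>
  yields \<open>p = (p 0 + cnj (p 0) * \<omega>) / (1 - \<omega>)\<close>, and the triangle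
  inequality bounds numerator and denominator.\<close>

lemma caratheodory_lower_bound:
  assumes p: "p holomorphic_on unit_disc" and pos: "\<And>z. z \<in> unit_disc \<Longrightarrow> Re (p z) > 0"
    and z: "z \<in> unit_disc"
  shows "cmod (p 0) * (1 - cmod z) \<le> cmod (p z) * (1 + cmod z)"
proof -
  define \<omega> where "\<omega> z = (p z - p 0) / (p z + cnj (p 0))" for z
  have p0: "Re (p 0) > 0" using pos by simp
  have \<omega>: "\<omega> holomorphic_on unit_disc"
    unfolding \<omega>_def[abs_def] using norm_cayley_less(1)[OF pos p0] p by (intro holomorphic_intros) auto
  have le: "cmod (\<omega> z) \<le> cmod z"
  proof (rule Schwarz_Lemma(1)[OF \<omega>])
    show "cmod (\<omega> y) < 1" if "cmod y < 1" for y
      unfolding \<omega>_def by (rule norm_cayley_less(2)) (use pos p0 that in auto)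
  qed (use z in \<open>auto simp: \<omega>_def\<close>)
  have "p z * (1 - \<omega> z) = p 0 + cnj (p 0) * \<omega> z"
    using norm_cayley_less(1)[OF pos[OF z] p0] by (simp add: \<omega>_def field_simps)
  then have eq: "cmod (p z) * cmod (1 - \<omega> z) = cmod (p 0 + cnj (p 0) * \<omega> z)"
    by (simp flip: norm_mult)
  have "cmod (p 0) * (1 - cmod z) \<le> cmod (p 0) * (1 - cmod (\<omega> z))"
    using le by (intro mult_left_mono) auto
  also have "\<dots> = cmod (p 0) - cmod (cnj (p 0) * \<omega> z)"
    by (simp add: norm_mult algebra_simps)
  also have "\<dots> \<le> cmod (p 0 + cnj (p 0) * \<omega> z)"
    by (rule norm_diff_ineq)
  also have "\<dots> \<le> cmod (p z) * (1 + cmod z)"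
    unfolding eq[symmetric] using le norm_triangle_ineq4[of 1 "\<omega> z"] by (intro mult_left_mono) auto
  finally show ?thesis .
qed

text \<open>The Noshiro--Warschawski argument: the difference quotient is the mean of
  \<open>H'\<close> over the segment from \<open>v\<close> to \<open>u\<close>. Here it is expressed
  by the monotonicity of \<open>\<phi>\<close>.\<close>

lemma Re_difference_quotient_pos:
  assumes cv: "convex \<Omega>" and uv: "u \<in> \<Omega>" "v \<in> \<Omega>" "u \<noteq> v"
    and der: "\<And>w. w \<in> \<Omega> \<Longrightarrow> (H has_field_derivative H' w) (at w)"
    and pos: "\<And>w. w \<in> \<Omega> \<Longrightarrow> Re (H' w) > 0"
  shows "Re ((H u - H v) / (u - v)) > 0"
proof -
  define \<phi> where "\<phi> s = Re (H (v + of_real s * (u - v)) / (u - v))" for s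
  have "\<phi> 0 < \<phi> 1"
  proof (rule DERIV_pos_imp_increasing[of 0 1 \<phi>])
    fix s :: real assume s: "0 \<le> s" "s \<le> 1"
    have "(1 - s) *\<^sub>R v + s *\<^sub>R u \<in> \<Omega>"
      using convexD_alt[OF cv uv(2,1) s] .
    also have "(1 - s) *\<^sub>R v + s *\<^sub>R u = v + of_real s * (u - v)"
      by (simp add: scaleR_conv_of_real algebra_simps)
    finally have in\<Omega>: "v + of_real s * (u - v) \<in> \<Omega>" .
    \<comment> \<open>The shift by \<open>v\<close> turns the segment into a piece of a ray from the
      origin.\<close>
    let ?K = "\<lambda>y. H (v + y) / (u - v)"
    have "(?K has_field_derivative H' (v + of_real s * (u - v)) / (u - v)) (at (of_real s * (u - v)))"
      using uv(3) by (auto intro!: derivative_eq_intros DERIV_chain2[where f = H and g = "\<lambda>y. v + y", OF der[OF in\<Omega>]])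
    from has_vector_derivative_along_ray[OF this]
    have "((\<lambda>s. H (v + of_real s * (u - v)) / (u - v)) has_vector_derivative
        H' (v + of_real s * (u - v))) (at s)"
      using uv(3) by simp
    then have "(\<phi> has_real_derivative Re (H' (v + of_real s * (u - v)))) (at s)"
      unfolding \<phi>_def[abs_def] by (rule has_vector_derivative_complex_iff[THEN iffD1, THEN conjunct1])
    then show "\<exists>y. (\<phi> has_real_derivative y) (at s) \<and> 0 < y"
      using pos[OF in\<Omega>] by blast
  qed simp
  then show ?thesis by (simp add: \<phi>_def diff_divide_distrib)
qed

text \<open>On the convex image of \<open>g\<close>, the function \<open>F\<close> composed with the
  inverse of \<open>g\<close> has derivative \<open>p\<close> composed with that inverse. The result
  makes \<open>F\<close> injective, and with \<open>w = 0\<close> it gives the sign condition needed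
  for the univalence of \<open>f\<close>.\<close>

lemma close_to_convex_quotient:
  assumes g: "convex_function g"
    and F: "\<And>z. z \<in> unit_disc \<Longrightarrow> (F has_field_derivative deriv g z * p z) (at z)"
    and pos: "\<And>z. z \<in> unit_disc \<Longrightarrow> Re (p z) > 0"
    and zw: "z \<in> unit_disc" "w \<in> unit_disc" "z \<noteq> w"
  shows "Re ((F z - F w) / (g z - g w)) > 0"
proof -
  obtain h where h: "h holomorphic_on g ` unit_disc"
    "\<And>z. z \<in> unit_disc \<Longrightarrow> h (g z) = z" "\<And>z. z \<in> unit_disc \<Longrightarrow> deriv g z * deriv h (g z) = 1"
    "open (g ` unit_disc)"
    using convex_function_inverse[OF g] by metis
  have "Re (((F \<circ> h) (g z) - (F \<circ> h) (g w)) / (g z - g w)) > 0"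
  proof (rule Re_difference_quotient_pos)
    show "convex (g ` unit_disc)" using g by (simp add: convex_function_def)
    show "g z \<noteq> g w" using h(2) zw by metis
    show "(F \<circ> h has_field_derivative p (h u)) (at u)" if u: "u \<in> g ` unit_disc" for u
    proof -
      obtain y where y: "y \<in> unit_disc" "u = g y" using u by auto
      have "(F \<circ> h has_field_derivative deriv g y * p y * deriv h u) (at u)"
        using y h(2) holomorphic_derivI[OF h(1) h(4) u] F[OF y(1)] by (intro DERIV_chain) auto
      moreover have "deriv g y * p y * deriv h u = p y"
        using h(3)[OF y(1)] y(2) by (simp add: mult.assoc mult.commute[of "p y"] mult.left_commute)
      ultimately have "(F \<circ> h has_field_derivative p y) (at u)" by (simp only:)
      then show ?thesis using y h(2) by simp
    qed
    show "Re (p (h u)) > 0" if "u \<in> g ` unit_disc" for u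
      using that h(2) pos by auto
  qed (use zw in auto)
  then show ?thesis using h(2) zw by simp
qed

section \<open>Growth and covering for univalent functions\<close>

text \<open>The hypothesis on \<open>H\<close> bounds the speed of the inverse function along rays, so that
  \<open>k (cmod (H\<inverse> (t * w))) - t * cmod w\<close> is nonincreasing as long as the ray stays in the image.\<close>

lemma univalent_lower_growth:
  fixes k \<kappa> :: "real \<Rightarrow> real"
  assumes H: "H holomorphic_on unit_disc" "inj_on H unit_disc" "H 0 = 0"
    and k0: "k 0 = 0" and k_cont: "continuous_on {0..1} k"
    and k_der: "\<And>x. 0 < x \<Longrightarrow> x < 1 \<Longrightarrow> (k has_real_derivative \<kappa> x) (at x)"
    and k_pos: "\<And>x. 0 < x \<Longrightarrow> x < 1 \<Longrightarrow> \<kappa> x > 0"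
    and H': "\<And>z. z \<in> unit_disc \<Longrightarrow> z \<noteq> 0 \<Longrightarrow> \<kappa> (cmod z) \<le> cmod (deriv H z)"
  shows "ball 0 (k 1) \<subseteq> H ` unit_disc"
    and "\<And>z. z \<in> unit_disc \<Longrightarrow> k (cmod z) \<le> cmod (H z)"
proof -
  let ?\<Omega> = "H ` unit_disc"
  obtain h where h: "h holomorphic_on ?\<Omega>"
    "\<And>z. z \<in> unit_disc \<Longrightarrow> deriv H z * deriv h (H z) = 1" "\<And>z. z \<in> unit_disc \<Longrightarrow> h (H z) = z"
    using holomorphic_has_inverse[OF H(1) open_ball H(2)] by metis
  have op: "open ?\<Omega>" by (rule open_mapping_thm3[OF H(1) open_ball H(2)])
  have h0: "h 0 = 0" using h(3)[of 0] H(3) by simp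
  have k_mono: "k x < k y" if "0 \<le> x" "x < y" "y \<le> 1" for x y
  proof (rule DERIV_pos_imp_increasing_open[OF that(2)])
    show "\<exists>d. (k has_real_derivative d) (at t) \<and> 0 < d" if "x < t" "t < y" for t
      using k_der[of t] k_pos[of t] that \<open>0 \<le> x\<close> \<open>y \<le> 1\<close> by auto
    show "continuous_on {x..y} k" using that by (intro continuous_on_subset[OF k_cont]) auto
  qed
  \<comment> \<open>The estimate is first proved on discs assumed to lie in the image, where the
    whole segment from 0 to \<open>w\<close> has preimages.\<close>
  have step: "k (cmod (h w)) \<le> cmod w" if d: "ball 0 d \<subseteq> ?\<Omega>" and w: "w \<in> ball 0 d" for d w
  proof (cases "w = 0")
    case True
    then show ?thesis using h0 k0 by simp
  next
    case False
    define u where "u t = cmod (h (of_real t * w))" for t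
    have in\<Omega>: "of_real t * w \<in> ?\<Omega>" if "0 \<le> t" "t \<le> 1" for t
    proof -
      have "t * cmod w \<le> 1 * cmod w" using that by (intro mult_right_mono) auto
      then have "cmod (of_real t * w) < d" using w that by (simp add: norm_mult)
      then show ?thesis using d by auto
    qed
    have "k (u 1) - 1 * cmod w \<le> k (u 0) - 0 * cmod w"
    proof (rule DERIV_nonpos_imp_decreasing_open[of 0 1 "\<lambda>t. k (u t) - t * cmod w"])
      fix t :: real assume t: "0 < t" "t < 1"
      obtain z where z: "z \<in> unit_disc" "of_real t * w = H z" using in\<Omega>[of t] t by auto
      have z0: "z \<noteq> 0" using z t False H(3) by auto
      have uz: "u t = cmod z" using z h(3) by (simp add: u_def)
      have "(h has_field_derivative deriv h (of_real t * w)) (at (of_real t * w))"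
        using holomorphic_derivI[OF h(1) op in\<Omega>[of t]] t by simp
      moreover have "h (of_real t * w) \<noteq> 0" using z z0 h(3) by simp
      ultimately obtain D where D: "(u has_real_derivative D) (at t)"
        "D \<le> cmod w * cmod (deriv h (of_real t * w))"
        by (rule norm_along_ray_derivative_le[of h _ t w, folded u_def])
      have u01: "0 < u t" "u t < 1" using uz z z0 by auto
      have "((\<lambda>t. k (u t) - t * cmod w) has_real_derivative \<kappa> (u t) * D - cmod w) (at t)"
        by (auto intro!: derivative_eq_intros DERIV_chain2[OF k_der[OF u01] D(1)])
      moreover have "\<kappa> (u t) * D \<le> cmod w"
      proof -
        have "\<kappa> (u t) * D \<le> \<kappa> (u t) * (cmod w * cmod (deriv h (H z)))"
          using D(2) k_pos[OF u01] z(2) by simp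
        also have "\<dots> \<le> cmod (deriv H z) * (cmod w * cmod (deriv h (H z)))"
          using H'[OF z(1) z0] uz by (intro mult_right_mono) auto
        also have "\<dots> = cmod w * cmod (deriv H z * deriv h (H z))"
          by (simp add: norm_mult)
        finally show ?thesis using h(2)[OF z(1)] by simp
      qed
      ultimately show "\<exists>y. ((\<lambda>t. k (u t) - t * cmod w) has_real_derivative y) (at t) \<and> y \<le> 0"
        by (metis diff_le_0_iff_le)
    next
      have "continuous_on {0..1} u"
        unfolding u_def[abs_def]
        by (intro continuous_intros continuous_on_compose2[OF holomorphic_on_imp_continuous_on[OF h(1)]])
           (use in\<Omega> in auto)
      moreover have "u ` {0..1} \<subseteq> {0..1}"
      proof clarify
        fix t :: real assume "t \<in> {0..1}"
        then obtain z where "z \<in> unit_disc" "of_real t * w = H z" using in\<Omega>[of t] by auto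
        then show "u t \<in> {0..1}" using h(3) by (auto simp: u_def less_imp_le)
      qed
      ultimately show "continuous_on {0..1} (\<lambda>t. k (u t) - t * cmod w)"
        by (intro continuous_intros continuous_on_compose2[OF k_cont])
    qed simp
    then show ?thesis using h0 k0 by (simp add: u_def)
  qed
  show cov: "ball 0 (k 1) \<subseteq> ?\<Omega>"
  proof (rule ccontr)
    assume "\<not> ball 0 (k 1) \<subseteq> ?\<Omega>"
    then obtain w0 where "w0 \<in> ball 0 (k 1)" and w0: "w0 \<notin> ?\<Omega>" by blast
    then have w0_less: "cmod w0 < k 1" by simp
    have "closed (- ?\<Omega>)" "- ?\<Omega> \<noteq> {}" using op w0 by auto
    \<comment> \<open>\<open>c\<close> is an omitted value nearest to 0. By \<open>step\<close>, the
      disc of radius \<open>cmod c < k 1\<close> is covered by the image of a compact disc of radius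
      \<open>\<rho> < 1\<close>; that image is closed, so it contains \<open>c\<close> as
      well.\<close>
    then obtain c where c: "c \<in> - ?\<Omega>" "\<And>y. y \<in> - ?\<Omega> \<Longrightarrow> dist 0 c \<le> dist 0 y"
      using distance_attains_inf[of "- ?\<Omega>" 0] by metis
    define d where "d = cmod c"
    have sub: "ball 0 d \<subseteq> ?\<Omega>" using c by (force simp: d_def)
    have "c \<noteq> 0" using c(1) H(3) by force
    then have d: "0 < d" "d < k 1" using c(2)[of w0] w0 w0_less by (auto simp: d_def)
    then obtain \<rho> where \<rho>: "0 \<le> \<rho>" "\<rho> \<le> 1" "k \<rho> = d"
      using IVT'[of k 0 d 1] k0 k_cont by auto
    have \<rho>1: "\<rho> < 1" using \<rho> d by (cases "\<rho> = 1") auto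
    have "ball 0 d \<subseteq> H ` cball 0 \<rho>"
    proof
      fix w :: complex assume w: "w \<in> ball 0 d"
      then obtain z where z: "z \<in> unit_disc" "w = H z" using sub by auto
      have "k (cmod z) \<le> cmod w" using step[OF sub w] z h(3) by simp
      also have "cmod w < k \<rho>" using w \<rho> by simp
      finally have "cmod z \<le> \<rho>"
        using k_mono[of \<rho> "cmod z"] \<rho> z(1) by (force simp: not_le)
      then show "w \<in> H ` cball 0 \<rho>" using z by auto
    qed
    moreover have "compact (H ` cball 0 \<rho>)"
      using \<rho>1 by (intro compact_continuous_image holomorphic_on_imp_continuous_on
          holomorphic_on_subset[OF H(1)]) auto
    ultimately have "closure (ball 0 d) \<subseteq> H ` cball 0 \<rho>"
      by (simp add: closure_minimal compact_imp_closed)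
    then have "c \<in> H ` cball 0 \<rho>" using d by (auto simp: d_def)
    then have "c \<in> ?\<Omega>" using \<rho>1 by auto
    then show False using c(1) by blast
  qed
  \<comment> \<open>Since \<open>k (cmod z) < k 1\<close>, a violation could only occur with
    \<open>H z\<close> in the covered disc, where \<open>step\<close> applies.\<close>
  show "k (cmod z) \<le> cmod (H z)" if z: "z \<in> unit_disc" for z
  proof (rule ccontr)
    assume n: "\<not> k (cmod z) \<le> cmod (H z)"
    have "k (cmod z) < k 1" using z by (intro k_mono) auto
    then have "H z \<in> ball 0 (k 1)" using n by simp
    from step[OF cov this] show False using n h(3)[OF z] by simp
  qed
qed

lemma class_C2_deriv_lower_bound:
  assumes f: "f \<in> class_C2" and z: "z \<in> unit_disc"
  shows "1 / (1 + cmod z)\<^sup>2 \<le> cmod (deriv f z)"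
proof -
  obtain g p where fh: "f holomorphic_on unit_disc" "f 0 = 0" "deriv f 0 = 1"
    and g: "convex_function g" "g 0 = 0" and p: "p holomorphic_on unit_disc"
    "\<And>z. z \<in> unit_disc \<Longrightarrow> Re (p z) > 0"
    and der: "\<And>z. z \<in> unit_disc \<Longrightarrow> ((\<lambda>w. w * deriv f w) has_field_derivative deriv g z * p z) (at z)"
    and p0: "deriv g 0 * p 0 = 1"
    by (rule class_C2E[OF f], rule that)
  define F where "F = (\<lambda>w. w * deriv f w)"
  \<comment> \<open>\<open>\<kappa>\<close> is the product of the lower bounds for
    \<open>cmod (deriv g z)\<close> and \<open>cmod (p z)\<close>, and \<open>k\<close> is its
    antiderivative vanishing at 0.\<close>
  define k where "k x = x / (1 + x)\<^sup>2" for x :: real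
  define \<kappa> where "\<kappa> x = (1 - x) / (1 + x) ^ 3" for x :: real
  have "k (cmod z) \<le> cmod (F z)"
  proof (rule univalent_lower_growth(2)[of F k \<kappa>, OF _ _ _ _ _ _ _ _ z])
    show "F holomorphic_on unit_disc"
      unfolding F_def by (intro holomorphic_on_mult holomorphic_on_ident holomorphic_deriv[OF fh(1)] open_ball)
    show "inj_on F unit_disc"
    proof (rule inj_onI, rule ccontr)
      fix u v assume "u \<in> unit_disc" "v \<in> unit_disc" "F u = F v" "u \<noteq> v"
      then show False
        using close_to_convex_quotient[OF g(1), of F p u v] der p by (simp add: F_def)
    qed
    show "F 0 = 0" "k 0 = 0" by (simp_all add: F_def k_def)
    show "continuous_on {0..1} k"
      unfolding k_def[abs_def] by (intro continuous_intros) auto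
    show "(k has_real_derivative \<kappa> x) (at x)" if "0 < x" "x < 1" for x
      unfolding k_def[abs_def] \<kappa>_def using that
      by (auto intro!: derivative_eq_intros simp: divide_simps) (auto simp: algebra_simps power_numeral_reduce)
    show "\<kappa> x > 0" if "0 < x" "x < 1" for x using that by (simp add: \<kappa>_def)
    show "\<kappa> (cmod y) \<le> cmod (deriv F y)" if y: "y \<in> unit_disc" for y
    proof -
      let ?r = "cmod y"
      have dF: "deriv F y = deriv g y * p y" using DERIV_imp_deriv[OF der[OF y]] by (simp add: F_def)
      have "1 - ?r = (cmod (deriv g 0) * cmod (p 0)) * (1 - ?r)"
        using p0 by (simp flip: norm_mult)
      also have "\<dots> = cmod (deriv g 0) * (cmod (p 0) * (1 - ?r))" by simp
      also have "\<dots> \<le> (cmod (deriv g y) * (1 + ?r)\<^sup>2) * (cmod (p y) * (1 + ?r))"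
        using y by (intro mult_mono convex_function_distortion g caratheodory_lower_bound p)  auto
      also have "\<dots> = cmod (deriv F y) * (1 + ?r) ^ 3"
        by (simp add: dF norm_mult power_numeral_reduce)
      finally show ?thesis
        unfolding \<kappa>_def by (simp add: divide_le_eq add_pos_nonneg)
    qed
  qed
  then have "cmod z * (1 / (1 + cmod z)\<^sup>2) \<le> cmod z * cmod (deriv f z)"
    by (simp add: k_def F_def norm_mult)
  \<comment> \<open>The factor \<open>cmod z\<close> cancels unless \<open>z = 0\<close>, where the
    normalisation \<open>deriv f 0 = 1\<close> takes over.\<close>
  then show ?thesis
    using fh(3) mult_le_cancel_left_pos[of "cmod z"] by (cases "z = 0") (simp, metis zero_less_norm_iff)
qed

section \<open>Univalence and the covered disc\<close>

text \<open>For \<open>s\<close> between 0 and 1, multiplication by \<open>s\<close> maps the convex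
  image into itself, so Schwarz's lemma gives
  \<open>cmod (h (of_real s * g z)) \<le> cmod z\<close>, with equality at \<open>s = 1\<close>. The
  derivative in \<open>s\<close> at 1 is therefore nonnegative, which is the claim for
  \<open>z / c\<close> with \<open>c = g z / deriv g z\<close>.\<close>

lemma convex_function_starlike:
  assumes g: "convex_function g" "g 0 = 0" and z: "z \<in> unit_disc" "z \<noteq> 0"
  shows "Re (z * deriv g z / g z) \<ge> 0"
proof -
  obtain h where h: "h holomorphic_on g ` unit_disc"
    "\<And>z. z \<in> unit_disc \<Longrightarrow> h (g z) = z" "\<And>z. z \<in> unit_disc \<Longrightarrow> deriv g z * deriv h (g z) = 1"
    "open (g ` unit_disc)"
    using convex_function_inverse[OF g(1)] by metis
  have gh: "g holomorphic_on unit_disc" "convex (g ` unit_disc)"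
    using g by (auto simp: convex_function_def)
  have in0: "0 \<in> g ` unit_disc" using g(2) by force
  have in\<Omega>: "of_real s * g y \<in> g ` unit_disc" if "0 \<le> s" "s \<le> 1" "y \<in> unit_disc" for s y
    using convexD_alt[OF gh(2) in0 _ that(1,2), of "g y"] that(3) by (simp add: scaleR_conv_of_real)
  have schwarz: "cmod (h (of_real s * g z)) \<le> cmod z" if s: "0 \<le> s" "s \<le> 1" for s
  proof (rule Schwarz_Lemma(1)[of "\<lambda>y. h (of_real s * g y)"])
    have "(h \<circ> (\<lambda>y. of_real s * g y)) holomorphic_on unit_disc"
      by (rule holomorphic_on_compose_gen[OF _ h(1)]) (use gh in\<Omega> s in \<open>auto intro!: holomorphic_intros\<close>)
    then show "(\<lambda>y. h (of_real s * g y)) holomorphic_on unit_disc" by (simp add: o_def)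
    show "cmod (h (of_real s * g y)) < 1" if "cmod y < 1" for y
      using in\<Omega>[OF s, of y] that h(2) by auto
  qed (use h(2)[of 0] g(2) z in auto)
  define w where "w = g z"
  define N where "N s = cmod (h (of_real s * w))" for s
  define c where "c = w * deriv h w"
  have w_in: "w \<in> g ` unit_disc" using z by (simp add: w_def)
  have hw: "h w = z" using h(2) z by (simp add: w_def)
  have der: "(N has_real_derivative inner c (sgn z)) (at 1)"
    using norm_along_ray_derivative[of h "deriv h w" 1 w] holomorphic_derivI[OF h(1) h(4) w_in] hw z(2)
    by (simp add: N_def[abs_def] c_def)
  have "inner c (sgn z) \<ge> 0"
  proof (rule ccontr)
    assume "\<not> inner c (sgn z) \<ge> 0"
    then obtain d where "d > 0" and d: "\<And>e. e > 0 \<Longrightarrow> e < d \<Longrightarrow> N 1 < N (1 - e)"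
      using DERIV_neg_dec_left[OF der] by auto
    \<comment> \<open>The cap at 1 keeps \<open>1 - e\<close> in the range where
      \<open>schwarz\<close> holds.\<close>
    define e where "e = min (d / 2) 1"
    have "N 1 < N (1 - e)" using \<open>d > 0\<close> by (intro d) (auto simp: e_def)
    moreover have "N (1 - e) \<le> cmod z"
      unfolding N_def w_def using \<open>d > 0\<close> by (intro schwarz) (auto simp: e_def)
    ultimately show False
      using hw by (simp add: N_def)
  qed
  then have "inner c z \<ge> 0"
    using z(2) by (simp add: sgn_div_norm zero_le_mult_iff)
  then have "Re (z * cnj c) \<ge> 0"
    by (simp add: inner_complex_def mult.commute)
  moreover have hd: "deriv g z * deriv h w = 1" using h(3)[OF z(1)] by (simp add: w_def)
  then have "deriv h w \<noteq> 0" "deriv g z = 1 / deriv h w" by (auto simp: eq_divide_eq)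
  then have "z * deriv g z / g z = z / c" by (simp add: c_def w_def[symmetric])
  moreover have "Re (z / c) = Re (z * cnj c) / (cmod c)\<^sup>2"
    by (simp add: complex_div_cnj[of z c] flip: of_real_power)
  ultimately show ?thesis by simp
qed

text \<open>Strict differentiability, from the mean value inequality for
  \<open>K y - deriv K c * y\<close>. Both points may vary, as is needed when two points with equal
  values merge in the limit.\<close>

lemma holomorphic_strict_derivative:
  assumes K: "K holomorphic_on \<Omega>" "open \<Omega>" and c: "c \<in> \<Omega>" and e: "e > 0"
  obtains d where "d > 0"
    "\<And>a b. a \<in> ball c d \<Longrightarrow> b \<in> ball c d \<Longrightarrow> cmod (K a - K b - deriv K c * (a - b)) \<le> e * cmod (a - b)"
proof -
  have "continuous_on \<Omega> (deriv K)"
    by (intro holomorphic_on_imp_continuous_on holomorphic_deriv K)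
  then have "isCont (deriv K) c" using K(2) c continuous_on_eq_continuous_at by blast
  then obtain d1 where d1: "d1 > 0" "\<And>y. dist y c < d1 \<Longrightarrow> dist (deriv K y) (deriv K c) < e"
    using e unfolding continuous_at_eps_delta by metis
  obtain d2 where d2: "d2 > 0" "ball c d2 \<subseteq> \<Omega>" using K(2) c open_contains_ball by blast
  define d where "d = min d1 d2"
  show ?thesis
  proof (rule that[of d])
    show "d > 0" using d1 d2 by (simp add: d_def)
    fix a b assume ab: "a \<in> ball c d" "b \<in> ball c d"
    have "cmod ((K a - deriv K c * a) - (K b - deriv K c * b)) \<le> e * cmod (a - b)"
    proof (rule field_differentiable_bound[of "ball c d" _ "\<lambda>y. deriv K y - deriv K c"])
      fix y assume y: "y \<in> ball c d"
      then have "y \<in> \<Omega>" using d2 by (auto simp: d_def)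
      from holomorphic_derivI[OF K this, THEN has_field_derivative_at_within]
      show "((\<lambda>y. K y - deriv K c * y) has_field_derivative deriv K y - deriv K c) (at y within ball c d)"
        by (auto intro!: derivative_eq_intros)
      show "cmod (deriv K y - deriv K c) \<le> e"
        using d1(2)[of y] y by (simp add: d_def dist_commute) (simp add: dist_norm norm_minus_commute)
    qed (use ab in auto)
    then show "cmod (K a - K b - deriv K c * (a - b)) \<le> e * cmod (a - b)"
      by (simp add: algebra_simps)
  qed
qed

lemma diff_bound_by_convex_function:
  assumes f: "f holomorphic_on unit_disc" and g: "convex_function g" and \<rho>: "\<rho> < 1"
  obtains C :: real where
    "\<And>z w. z \<in> cball 0 \<rho> \<Longrightarrow> w \<in> cball 0 \<rho> \<Longrightarrow> cmod (f z - f w) \<le> C * cmod (g z - g w)"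
proof -
  obtain h where h: "h holomorphic_on g ` unit_disc"
    "\<And>z. z \<in> unit_disc \<Longrightarrow> h (g z) = z" "open (g ` unit_disc)"
    using convex_function_inverse[OF g] by metis
  have gh: "g holomorphic_on unit_disc" "convex (g ` unit_disc)"
    using g by (auto simp: convex_function_def)
  have sub: "cball 0 \<rho> \<subseteq> unit_disc" using \<rho> by auto
  define S where "S = convex hull (g ` cball 0 \<rho>)"
  have "compact S"
    unfolding S_def using sub gh(1)
    by (intro compact_convex_hull compact_continuous_image holomorphic_on_imp_continuous_on)
       (auto intro: holomorphic_on_subset)
  have S\<Omega>: "S \<subseteq> g ` unit_disc"
    unfolding S_def using sub gh(2) by (intro hull_minimal) auto
  have K: "(f \<circ> h) holomorphic_on g ` unit_disc"
    using h(2) by (intro holomorphic_on_compose_gen[OF h(1) f]) auto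
  have "continuous_on S (deriv (f \<circ> h))"
    using holomorphic_on_imp_continuous_on[OF holomorphic_deriv[OF K h(3)]] S\<Omega>
    by (rule continuous_on_subset)
  then have "bounded (deriv (f \<circ> h) ` S)"
    using \<open>compact S\<close> by (intro compact_imp_bounded compact_continuous_image)
  then obtain C where C: "\<And>y. y \<in> S \<Longrightarrow> cmod (deriv (f \<circ> h) y) \<le> C"
    unfolding bounded_iff by auto
  show ?thesis
  proof (rule that[of C])
    fix z w :: complex assume zw: "z \<in> cball 0 \<rho>" "w \<in> cball 0 \<rho>"
    have "cmod ((f \<circ> h) (g z) - (f \<circ> h) (g w)) \<le> C * cmod (g z - g w)"
    proof (rule field_differentiable_bound[of S _ "deriv (f \<circ> h)"])
      show "convex S" by (simp add: S_def)
      show "(f \<circ> h has_field_derivative deriv (f \<circ> h) y) (at y within S)" if "y \<in> S" for y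
        using holomorphic_derivI[OF K h(3), of y] S\<Omega> that has_field_derivative_at_within by blast
      show "g z \<in> S" "g w \<in> S" using zw by (auto simp: S_def intro: hull_inc)
    qed (use C in auto)
    then show "cmod (f z - f w) \<le> C * cmod (g z - g w)"
      using h(2)[of z] h(2)[of w] zw \<rho> by auto
  qed
qed

text \<open>If \<open>f + t g\<close> takes equal values at \<open>z\<close> and \<open>w\<close>, let the two points flow with velocities
  \<open>- z / A\<close> and \<open>- w / B\<close>. To first order this subtracts multiples of \<open>g z\<close> and \<open>g w\<close> from the values
  of \<open>f + t g\<close>, which is the effect of increasing \<open>t\<close>; the local inverse of the difference
  quotient turns the first-order statement into an exact one.\<close>

lemma coincidence_persists:
  fixes t :: real
  assumes f: "f holomorphic_on unit_disc" and g: "g holomorphic_on unit_disc" "inj_on g unit_disc"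
    and zw: "z \<in> unit_disc" "w \<in> unit_disc" "z \<noteq> w"
    and eq: "f z + of_real t * g z = f w + of_real t * g w"
    and A: "z * (deriv f z + of_real t * deriv g z) = A * g z" "Re A > 0"
    and B: "w * (deriv f w + of_real t * deriv g w) = B * g w" "Re B > 0"
  obtains \<delta> z' w' where "\<delta> > 0" "z' \<noteq> w'" "cmod z' \<le> cmod z" "cmod w' \<le> cmod w"
    "f z' + of_real (t + \<delta>) * g z' = f w' + of_real (t + \<delta>) * g w'"
proof -
  have A0: "A \<noteq> 0" and B0: "B \<noteq> 0" using A B by auto
  \<comment> \<open>The exponential form has the required velocity at 0 and makes the modulus shrink
    exactly when \<open>Re (\<epsilon> / A)\<close> is positive; \<open>\<epsilon>\<close> is
    complex.\<close>
  define Z where "Z \<epsilon> = z * exp (- \<epsilon> / A)" for \<epsilon>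
  define W where "W \<epsilon> = w * exp (- \<epsilon> / B)" for \<epsilon>
  define U where "U = Z -` unit_disc \<inter> W -` unit_disc \<inter> (\<lambda>\<epsilon>. Z \<epsilon> - W \<epsilon>) -` (- {0})"
  have hol: "Z holomorphic_on UNIV" "W holomorphic_on UNIV"
    unfolding Z_def[abs_def] W_def[abs_def] using A0 B0 by (auto intro!: holomorphic_intros)
  then have cont: "continuous_on UNIV Z" "continuous_on UNIV W"
    by (auto intro: holomorphic_on_imp_continuous_on)
  have "open U"
    unfolding U_def by (intro open_Int open_vimage continuous_intros cont) auto
  have U0: "0 \<in> U" using zw by (simp add: U_def Z_def W_def)
  \<comment> \<open>For \<open>\<epsilon>\<close> in \<open>U\<close>, the function
    \<open>f + s g\<close> takes equal values at the two moved points exactly when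
    \<open>Q \<epsilon> = - s\<close>.\<close>
  define Q where "Q \<epsilon> = (f (Z \<epsilon>) - f (W \<epsilon>)) / (g (Z \<epsilon>) - g (W \<epsilon>))" for \<epsilon>
  have gne: "g (Z \<epsilon>) - g (W \<epsilon>) \<noteq> 0" if "\<epsilon> \<in> U" for \<epsilon>
    using that g(2) by (auto simp: U_def inj_on_def)
  have Q_hol: "Q holomorphic_on U"
  proof -
    have "(\<phi> \<circ> Z) holomorphic_on U \<and> (\<phi> \<circ> W) holomorphic_on U" if "\<phi> holomorphic_on unit_disc" for \<phi>
      using hol by (intro conjI holomorphic_on_compose_gen[OF _ that])
        (auto intro: holomorphic_on_subset simp: U_def)
    from this[OF f] this[OF g(1)] show ?thesis
      unfolding Q_def[abs_def] using gne by (auto intro!: holomorphic_intros simp: o_def)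
  qed
  define G where "G = g z - g w"
  have G0: "G \<noteq> 0" using gne[OF U0] by (simp add: G_def Z_def W_def)
  have fdiff: "f z - f w = - of_real t * G"
    using eq by (simp add: G_def algebra_simps)
  have Q0: "Q 0 = - of_real t"
    using fdiff G0 by (simp add: Q_def Z_def W_def G_def[symmetric])
  have dZ: "(Z has_field_derivative - z / A) (at 0)" and dW: "(W has_field_derivative - w / B) (at 0)"
    unfolding Z_def[abs_def] W_def[abs_def] using A0 B0 by (auto intro!: derivative_eq_intros)
  have Z0: "Z 0 = z" "W 0 = w" by (simp_all add: Z_def W_def)
  have chain: "((\<lambda>\<epsilon>. \<phi> (Z \<epsilon>) - \<phi> (W \<epsilon>)) has_field_derivative
      deriv \<phi> z * (- z / A) - deriv \<phi> w * (- w / B)) (at 0)" if "\<phi> holomorphic_on unit_disc" for \<phi>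
    using holomorphic_derivI[OF that open_ball zw(1)] holomorphic_derivI[OF that open_ball zw(2)]
    by (intro DERIV_diff DERIV_chain2[where f = \<phi>] dZ dW) (simp_all add: Z0)
  have "(Q has_field_derivative - 1) (at 0)"
  proof -
    let ?F = "deriv f z * (- z / A) - deriv f w * (- w / B)"
    let ?G = "deriv g z * (- z / A) - deriv g w * (- w / B)"
    have "(Q has_field_derivative (?F * G - (f z - f w) * ?G) / (G * G)) (at 0)"
      using DERIV_divide[OF chain[OF f] chain[OF g(1)]] G0 unfolding Q_def[abs_def]
      by (simp add: Z0 G_def[symmetric])
    also have "(?F * G - (f z - f w) * ?G) / (G * G) = (?F + of_real t * ?G) / G"
      unfolding fdiff using G0 by (simp add: divide_simps) (simp add: algebra_simps)
    also have "?F + of_real t * ?G = - (z * (deriv f z + of_real t * deriv g z)) / A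
        + w * (deriv f w + of_real t * deriv g w) / B"
      by (simp add: algebra_simps add_divide_distrib diff_divide_distrib)
    also have "\<dots> = - G" unfolding A(1) B(1) using A0 B0 by (simp add: G_def)
    finally show ?thesis using G0 by simp
  qed
  then have Q': "deriv Q 0 = - 1" by (rule DERIV_imp_deriv)
  obtain r where r: "r > 0" "ball 0 r \<subseteq> U" "inj_on Q (ball 0 r)"
    using has_complex_derivative_locally_injective[OF Q_hol U0 \<open>open U\<close>] Q' by auto
  have Qr: "Q holomorphic_on ball 0 r" using Q_hol r(2) by (rule holomorphic_on_subset)
  obtain k where k: "k holomorphic_on Q ` ball 0 r"
    "\<And>\<epsilon>. \<epsilon> \<in> ball 0 r \<Longrightarrow> deriv Q \<epsilon> * deriv k (Q \<epsilon>) = 1" "\<And>\<epsilon>. \<epsilon> \<in> ball 0 r \<Longrightarrow> k (Q \<epsilon>) = \<epsilon>"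
    using holomorphic_has_inverse[OF Qr open_ball r(3)] by metis
  have op: "open (Q ` ball 0 r)" by (rule open_mapping_thm3[OF Qr open_ball r(3)])
  have mt: "- of_real t \<in> Q ` ball 0 r" using Q0 r(1) by (metis centre_in_ball image_eqI)
  have "deriv k (- of_real t) = - 1"
    using k(2)[of 0] r(1) Q0 Q' by (simp add: minus_equation_iff)
  then have dk: "(k has_field_derivative - 1) (at (- of_real t))"
    using holomorphic_derivI[OF k(1) op mt] by simp
  have k0: "k (- of_real t) = 0" using k(3)[of 0] r(1) Q0 by simp
  \<comment> \<open>The parameter belonging to \<open>t + \<delta>\<close> is
    \<open>\<delta>\<close> to first order, so dividing it by \<open>A\<close> or \<open>B\<close>
    leaves a positive real part and neither point moves outward.\<close>
  have pos: "\<exists>d>0. \<forall>\<delta>>0. \<delta> < d \<longrightarrow> Re (k (- of_real t - of_real \<delta>) / C) > 0" if C: "Re C > 0" for C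
  proof -
    have C0: "C \<noteq> 0" using C by auto
    have "((\<lambda>y. k (- of_real t - y) / C) has_field_derivative 1 / C) (at (of_real 0 * 1))"
      using C0 by (auto intro!: derivative_eq_intros DERIV_chain2[where f = k and g = "\<lambda>y. - of_real t - y"] dk)
    from has_vector_derivative_along_ray[OF this]
    have "((\<lambda>\<delta>. k (- of_real t - of_real \<delta>) / C) has_vector_derivative 1 / C) (at 0)" by simp
    then have "((\<lambda>\<delta>. Re (k (- of_real t - of_real \<delta>) / C)) has_real_derivative Re (1 / C)) (at 0)"
      by (rule has_vector_derivative_complex_iff[THEN iffD1, THEN conjunct1])
    moreover have "Re (1 / C) > 0"
      using C by (simp add: Re_divide zero_less_divide_iff sum_power2_gt_zero_iff)
    ultimately show ?thesis using DERIV_pos_inc_right k0 by fastforce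
  qed
  obtain d1 where d1: "d1 > 0" "\<And>\<delta>. 0 < \<delta> \<Longrightarrow> \<delta> < d1 \<Longrightarrow> Re (k (- of_real t - of_real \<delta>) / A) > 0"
    using pos[OF A(2)] by auto
  obtain d2 where d2: "d2 > 0" "\<And>\<delta>. 0 < \<delta> \<Longrightarrow> \<delta> < d2 \<Longrightarrow> Re (k (- of_real t - of_real \<delta>) / B) > 0"
    using pos[OF B(2)] by auto
  obtain d3 where d3: "d3 > 0" "ball (- of_real t) d3 \<subseteq> Q ` ball 0 r"
    using op mt open_contains_ball by blast
  define \<delta> where "\<delta> = min d1 (min d2 d3) / 2"
  have \<delta>: "0 < \<delta>" "\<delta> < d1" "\<delta> < d2" "\<delta> < d3"
    using d1(1) d2(1) d3(1) by (auto simp: \<delta>_def min_def)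
  have "- of_real t - of_real \<delta> \<in> ball (- of_real t :: complex) d3"
    using \<delta> by (simp add: dist_norm)
  then obtain \<epsilon> where \<epsilon>: "\<epsilon> \<in> ball 0 r" "Q \<epsilon> = - of_real t - of_real \<delta>"
    using d3(2) by (metis imageE subsetD)
  then have k\<epsilon>: "k (- of_real t - of_real \<delta>) = \<epsilon>" using k(3) by metis
  have \<epsilon>U: "\<epsilon> \<in> U" using \<epsilon> r(2) by auto
  show ?thesis
  proof (rule that[of \<delta> "Z \<epsilon>" "W \<epsilon>"])
    show "\<delta> > 0" by fact
    show "Z \<epsilon> \<noteq> W \<epsilon>" using \<epsilon>U by (auto simp: U_def)
    have "Re (\<epsilon> / A) > 0" "Re (\<epsilon> / B) > 0" using d1(2)[of \<delta>] d2(2)[of \<delta>] \<delta> k\<epsilon> by auto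
    then show "cmod (Z \<epsilon>) \<le> cmod z" "cmod (W \<epsilon>) \<le> cmod w"
      by (simp_all add: Z_def W_def norm_mult mult_left_le)
    have "f (Z \<epsilon>) - f (W \<epsilon>) = (- of_real t - of_real \<delta>) * (g (Z \<epsilon>) - g (W \<epsilon>))"
      using \<epsilon>(2) gne[OF \<epsilon>U] by (simp add: Q_def divide_eq_eq)
    then show "f (Z \<epsilon>) + of_real (t + \<delta>) * g (Z \<epsilon>) = f (W \<epsilon>) + of_real (t + \<delta>) * g (W \<epsilon>)"
      by (simp add: algebra_simps)
  qed
qed

text \<open>On a closed disc the set of \<open>t \<ge> 0\<close> for which \<open>f + t g\<close> is not injective is bounded and
  contains its supremum, yet by the previous lemma it has no largest element.\<close>

lemma univalent_if_quotient_pos: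
  assumes f: "f holomorphic_on unit_disc" and g: "convex_function g" "g 0 = 0"
    and pos: "\<And>z. z \<in> unit_disc \<Longrightarrow> z \<noteq> 0 \<Longrightarrow> Re (z * deriv f z / g z) > 0"
    and pos0: "Re (deriv f 0 / deriv g 0) > 0"
  shows "inj_on f unit_disc"
proof (rule inj_onI, rule ccontr)
  fix u v assume uv: "u \<in> unit_disc" "v \<in> unit_disc" "f u = f v" "u \<noteq> v"
  have gh: "g holomorphic_on unit_disc" "inj_on g unit_disc"
    using g by (auto simp: convex_function_def)
  have gne: "g z \<noteq> g w" if "z \<in> unit_disc" "w \<in> unit_disc" "z \<noteq> w" for z w
    using that gh(2) by (auto simp: inj_on_def)
  obtain h where h: "h holomorphic_on g ` unit_disc"
    "\<And>z. z \<in> unit_disc \<Longrightarrow> h (g z) = z" "\<And>z. z \<in> unit_disc \<Longrightarrow> deriv g z * deriv h (g z) = 1"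
    "open (g ` unit_disc)"
    using convex_function_inverse[OF g(1)] by metis
  define \<rho> where "\<rho> = max (cmod u) (cmod v)"
  have \<rho>: "\<rho> < 1" using uv by (simp add: \<rho>_def)
  have sub: "cball 0 \<rho> \<subseteq> unit_disc" using \<rho> by auto
  define P where "P t z w \<longleftrightarrow> z \<in> cball 0 \<rho> \<and> w \<in> cball 0 \<rho> \<and> z \<noteq> w \<and>
    f z + of_real t * g z = f w + of_real t * g w" for t :: real and z w
  define S where "S = {t. 0 \<le> t \<and> (\<exists>z w. P t z w)}"
  have "P 0 u v" using uv by (simp add: P_def \<rho>_def)
  then have S0: "0 \<in> S" by (auto simp: S_def)
  obtain C where C: "\<And>z w. z \<in> cball 0 \<rho> \<Longrightarrow> w \<in> cball 0 \<rho> \<Longrightarrow> cmod (f z - f w) \<le> C * cmod (g z - g w)"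
    using diff_bound_by_convex_function[OF f g(1) \<rho>] by metis
  have "t \<le> C" if t: "t \<in> S" for t
  proof -
    obtain z w where zw: "P t z w" "0 \<le> t" using t by (auto simp: S_def)
    then have "f z - f w = - of_real t * (g z - g w)" by (auto simp: P_def algebra_simps)
    then have "t * cmod (g z - g w) = cmod (f z - f w)" using zw(2) by (simp add: norm_mult)
    also have "\<dots> \<le> C * cmod (g z - g w)" using C zw(1) by (simp add: P_def)
    finally have "t * cmod (g z - g w) \<le> C * cmod (g z - g w)" .
    moreover have "g z \<noteq> g w" using gne[of z w] zw(1) \<rho> by (auto simp: P_def)
    ultimately show "t \<le> C" by simp
  qed
  then have bdd: "bdd_above S" by (rule bdd_aboveI)
  define T where "T = Sup S"
  have T0: "0 \<le> T" using cSup_upper[OF S0 bdd] by (simp add: T_def)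
  \<comment> \<open>Coincidences with parameters tending to the supremum \<open>T\<close>; a
    convergent subsequence of the point pairs gives a candidate coincidence at \<open>T\<close>
    itself.\<close>
  have "\<exists>t z w. t \<in> S \<and> T - inverse (Suc n) < t \<and> t \<le> T \<and> P t z w" for n
  proof -
    have "T - inverse (Suc n) < Sup S" by (simp add: T_def)
    then obtain t where "t \<in> S" "T - inverse (Suc n) < t"
      using less_cSup_iff[OF _ bdd] S0 by blast
    moreover have "t \<le> T" using cSup_upper[OF \<open>t \<in> S\<close> bdd] by (simp add: T_def)
    ultimately show ?thesis by (auto simp: S_def)
  qed
  then obtain \<tau> z w where seq: "\<And>n. T - inverse (Suc n) < \<tau> n" "\<And>n. \<tau> n \<le> T"
    "\<And>n. P (\<tau> n) (z n) (w n)"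
    by metis
  have \<tau>_lim: "\<tau> \<longlonglongrightarrow> T"
  proof (rule tendsto_sandwich[of "\<lambda>n. T - inverse (real (Suc n))" _ _ "\<lambda>_. T"])
    have "(\<lambda>n. T - inverse (real (Suc n))) \<longlonglongrightarrow> T - 0"
      by (intro tendsto_intros LIMSEQ_inverse_real_of_nat)
    then show "(\<lambda>n. T - inverse (real (Suc n))) \<longlonglongrightarrow> T" by simp
  qed (use seq in \<open>auto intro!: always_eventually less_imp_le\<close>)
  have "seq_compact (cball 0 \<rho> \<times> cball 0 \<rho> :: (complex \<times> complex) set)"
    by (intro compact_imp_seq_compact compact_Times compact_cball)
  moreover have "\<forall>n. (z n, w n) \<in> cball 0 \<rho> \<times> cball 0 \<rho>" using seq(3) by (auto simp: P_def)
  ultimately obtain l s where l: "l \<in> cball 0 \<rho> \<times> cball 0 \<rho>" "strict_mono (s :: nat \<Rightarrow> nat)"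
    "((\<lambda>n. (z n, w n)) \<circ> s) \<longlonglongrightarrow> l"
    by (rule seq_compactE)
  define a b where "a = fst l" and "b = snd l"
  have a: "a \<in> cball 0 \<rho>" "(\<lambda>n. z (s n)) \<longlonglongrightarrow> a" and b: "b \<in> cball 0 \<rho>" "(\<lambda>n. w (s n)) \<longlonglongrightarrow> b"
    using l tendsto_fst[OF l(3)] tendsto_snd[OF l(3)] by (auto simp: a_def b_def o_def)
  have \<tau>s: "(\<lambda>n. \<tau> (s n)) \<longlonglongrightarrow> T"
    using LIMSEQ_subseq_LIMSEQ[OF \<tau>_lim l(2)] by (simp add: o_def)
  have ab: "a \<in> unit_disc" "b \<in> unit_disc" using a b sub by auto
  have lim: "(\<lambda>n. \<phi> (z (s n))) \<longlonglongrightarrow> \<phi> a" "(\<lambda>n. \<phi> (w (s n))) \<longlonglongrightarrow> \<phi> b"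
    if "\<phi> holomorphic_on unit_disc" for \<phi>
  proof -
    have "isCont \<phi> a" "isCont \<phi> b"
      using holomorphic_on_imp_continuous_on[OF that] ab continuous_on_eq_continuous_at[OF open_ball] by blast+
    then show "(\<lambda>n. \<phi> (z (s n))) \<longlonglongrightarrow> \<phi> a" "(\<lambda>n. \<phi> (w (s n))) \<longlonglongrightarrow> \<phi> b"
      using a b isCont_tendsto_compose by blast+
  qed
  have eq: "f a + of_real T * g a = f b + of_real T * g b"
  proof (rule LIMSEQ_unique)
    show "(\<lambda>n. f (z (s n)) + of_real (\<tau> (s n)) * g (z (s n))) \<longlonglongrightarrow> f a + of_real T * g a"
      by (intro tendsto_intros lim f gh \<tau>s)
    have "(\<lambda>n. f (w (s n)) + of_real (\<tau> (s n)) * g (w (s n))) \<longlonglongrightarrow> f b + of_real T * g b"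
      by (intro tendsto_intros lim f gh \<tau>s)
    moreover have "f (z n) + of_real (\<tau> n) * g (z n) = f (w n) + of_real (\<tau> n) * g (w n)" for n
      using seq(3) by (simp add: P_def)
    ultimately show "(\<lambda>n. f (z (s n)) + of_real (\<tau> (s n)) * g (z (s n))) \<longlonglongrightarrow> f b + of_real T * g b"
      by simp
  qed
  \<comment> \<open>At 0 both sides of \<open>A_eq\<close> vanish, so any value with positive real
    part would do there.\<close>
  define A where "A y = (if y = 0 then 1 else y * (deriv f y + of_real T * deriv g y) / g y)" for y
  have g_nz: "g y \<noteq> 0" if "y \<in> unit_disc" "y \<noteq> 0" for y
    using gne[of y 0] that g(2) by auto
  have A_pos: "Re (A y) > 0" if y: "y \<in> unit_disc" for y
  proof (cases "y = 0")
    case False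
    have "A y = y * deriv f y / g y + of_real T * (y * deriv g y / g y)"
      using False by (simp add: A_def add_divide_distrib distrib_left mult_ac)
    then have "Re (A y) = Re (y * deriv f y / g y) + T * Re (y * deriv g y / g y)"
      by (simp only: plus_complex.sel times_complex.sel Re_complex_of_real Im_complex_of_real mult_zero_left diff_zero)
    then show ?thesis
      using pos[OF y False] convex_function_starlike[OF g y False] T0 by (smt (verit) mult_nonneg_nonneg)
  qed (simp add: A_def)
  have A_eq: "y * (deriv f y + of_real T * deriv g y) = A y * g y" if "y \<in> unit_disc" for y
    using g_nz[OF that] g(2) by (simp add: A_def)
  \<comment> \<open>If the pairs merged, the difference quotients of \<open>?K\<close>, which equal
    \<open>- \<tau> (s n)\<close>, would force \<open>deriv ?K ?c = - of_real T\<close>. Then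
    \<open>deriv f a + of_real T * deriv g a = 0\<close>, against \<open>A_pos\<close>, or against
    \<open>pos0\<close> if \<open>a = 0\<close>.\<close>
  have "a \<noteq> b"
  proof
    assume "a = b"
    let ?K = "f \<circ> h" and ?c = "g a"
    have K: "?K holomorphic_on g ` unit_disc"
      using h(2) by (intro holomorphic_on_compose_gen[OF h(1) f]) auto
    have c: "?c \<in> g ` unit_disc" using ab by simp
    have dK: "deriv ?K ?c = deriv f a * deriv h ?c"
    proof (rule DERIV_imp_deriv, rule DERIV_chain)
      show "(f has_field_derivative deriv f a) (at (h ?c))"
        using holomorphic_derivI[OF f open_ball ab(1)] h(2)[OF ab(1)] by simp
      show "(h has_field_derivative deriv h ?c) (at ?c)"
        using holomorphic_derivI[OF h(1) h(4) c] .
    qed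
    have ne: "deriv ?K ?c + of_real T \<noteq> 0"
    proof
      assume "deriv ?K ?c + of_real T = 0"
      then have "deriv g a * (deriv f a * deriv h ?c + of_real T) = 0" by (simp add: dK)
      then have *: "deriv f a + of_real T * deriv g a = 0"
        using h(3)[OF ab(1)] by (simp add: algebra_simps)
      show False
      proof (cases "a = 0")
        case True
        then have "deriv f 0 = - of_real T * deriv g 0"
          using * by (simp add: eq_neg_iff_add_eq_0)
        then have "deriv f 0 / deriv g 0 = - of_real T"
          using convex_function_deriv_nonzero[OF g(1), of 0] by simp
        then show False using pos0 T0 by simp
      next
        case False
        then show False using A_pos[OF ab(1)] * by (simp add: A_def)
      qed
    qed
    define e where "e = cmod (deriv ?K ?c + of_real T) / 2"
    have "e > 0" using ne by (simp add: e_def)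
    then obtain d where d: "d > 0" "\<And>x y. x \<in> ball ?c d \<Longrightarrow> y \<in> ball ?c d \<Longrightarrow>
        cmod (?K x - ?K y - deriv ?K ?c * (x - y)) \<le> e * cmod (x - y)"
      using holomorphic_strict_derivative[OF K h(4) c] by metis
    have "\<forall>\<^sub>F n in sequentially. cmod (of_real (\<tau> (s n)) + deriv ?K ?c) \<le> e"
    proof -
      have "\<forall>\<^sub>F n in sequentially. g (z (s n)) \<in> ball ?c d"
        "\<forall>\<^sub>F n in sequentially. g (w (s n)) \<in> ball ?c d"
        using tendstoD[OF lim(1)[OF gh(1)] d(1)] tendstoD[OF lim(2)[OF gh(1)] d(1)] \<open>a = b\<close>
        by (simp_all add: dist_commute)
      then show ?thesis
      proof eventually_elim
        case (elim n)
        let ?x = "g (z (s n))" and ?y = "g (w (s n))"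
        have Pn: "P (\<tau> (s n)) (z (s n)) (w (s n))" by (rule seq(3))
        then have D: "z (s n) \<in> unit_disc" "w (s n) \<in> unit_disc" using sub by (auto simp: P_def)
        then have "?K ?x = f (z (s n))" "?K ?y = f (w (s n))" using h(2) by auto
        then have "?K ?x - ?K ?y = - of_real (\<tau> (s n)) * (?x - ?y)"
          using Pn by (simp add: P_def algebra_simps)
        then have "?K ?x - ?K ?y - deriv ?K ?c * (?x - ?y) = - ((of_real (\<tau> (s n)) + deriv ?K ?c) * (?x - ?y))"
          by (simp add: algebra_simps)
        then have "cmod (of_real (\<tau> (s n)) + deriv ?K ?c) * cmod (?x - ?y) \<le> e * cmod (?x - ?y)"
          using d(2)[OF elim] by (simp add: norm_mult)
        moreover have "?x - ?y \<noteq> 0" using gne[OF D] Pn by (simp add: P_def)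
        ultimately show ?case by simp
      qed
    qed
    moreover have "(\<lambda>n. cmod (of_real (\<tau> (s n)) + deriv ?K ?c)) \<longlonglongrightarrow> cmod (of_real T + deriv ?K ?c)"
      by (intro tendsto_intros \<tau>s)
    ultimately have "cmod (of_real T + deriv ?K ?c) \<le> e"
      by (intro tendsto_upperbound) auto
    then show False using \<open>e > 0\<close> by (simp add: e_def add.commute)
  qed
  then obtain \<delta> z' w' where *: "\<delta> > 0" "z' \<noteq> w'" "cmod z' \<le> cmod a" "cmod w' \<le> cmod b"
    "f z' + of_real (T + \<delta>) * g z' = f w' + of_real (T + \<delta>) * g w'"
    using coincidence_persists[OF f gh ab _ eq A_eq[OF ab(1)] A_pos[OF ab(1)] A_eq[OF ab(2)] A_pos[OF ab(2)]]
    by metis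
  then have "P (T + \<delta>) z' w'" using a(1) b(1) by (simp add: P_def)
  then have "T + \<delta> \<in> S" using T0 *(1) by (auto simp: S_def)
  then have "T + \<delta> \<le> T" using cSup_upper[OF _ bdd] unfolding T_def by blast
  then show False using *(1) by simp
qed

text \<open>Close-to-convexity of \<open>z f'\<close>, compared with its value at 0, supplies the
  positivity of \<open>z f' / g\<close>; at the origin this quotient becomes
  \<open>p 0\<close>.\<close>

lemma class_C2_univalent:
  assumes f: "f \<in> class_C2"
  shows "inj_on f unit_disc"
proof -
  obtain g p where fh: "f holomorphic_on unit_disc" "f 0 = 0" "deriv f 0 = 1"
    and g: "convex_function g" "g 0 = 0" and p: "p holomorphic_on unit_disc"
    "\<And>z. z \<in> unit_disc \<Longrightarrow> Re (p z) > 0"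
    and der: "\<And>z. z \<in> unit_disc \<Longrightarrow> ((\<lambda>w. w * deriv f w) has_field_derivative deriv g z * p z) (at z)"
    and p0: "deriv g 0 * p 0 = 1"
    by (rule class_C2E[OF f], rule that)
  show ?thesis
  proof (rule univalent_if_quotient_pos[OF fh(1) g])
    show "Re (z * deriv f z / g z) > 0" if "z \<in> unit_disc" "z \<noteq> 0" for z
      using close_to_convex_quotient[OF g(1) der p(2) that(1) _ that(2)] g(2) by simp
    have "deriv f 0 / deriv g 0 = p 0"
      using p0 fh(3) convex_function_deriv_nonzero[OF g(1), of 0] by (simp add: field_simps)
    then show "Re (deriv f 0 / deriv g 0) > 0" using p(2)[of 0] by simp
  qed
qed

lemma class_C2_half_le_infdist:
  assumes f: "f \<in> class_C2"
  shows "1 / 2 \<le> infdist (f 0) (frontier (f ` unit_disc))"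
proof -
  have fh: "f holomorphic_on unit_disc" "f 0 = 0" using f by (auto simp: class_C2_def)
  note inj = class_C2_univalent[OF f]
  have op: "open (f ` unit_disc)" by (rule open_mapping_thm3[OF fh(1) open_ball inj])
  \<comment> \<open>The antiderivative of the lower bound for \<open>cmod (deriv f z)\<close>;
    \<open>k 1\<close> is the covered radius \<open>1 / 2\<close>.\<close>
  define k where "k x = x / (1 + x)" for x :: real
  have "ball 0 (k 1) \<subseteq> f ` unit_disc"
  proof (rule univalent_lower_growth(1)[OF fh(1) inj fh(2), of k "\<lambda>x. 1 / (1 + x)\<^sup>2"])
    show "continuous_on {0..1} k" unfolding k_def[abs_def] by (intro continuous_intros) auto
    show "(k has_real_derivative 1 / (1 + x)\<^sup>2) (at x)" if "0 < x" for x
      unfolding k_def[abs_def] using that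
      by (auto intro!: derivative_eq_intros simp: power2_eq_square)
    show "1 / (1 + cmod z)\<^sup>2 \<le> cmod (deriv f z)" if "z \<in> unit_disc" for z
      by (rule class_C2_deriv_lower_bound[OF f that])
  qed (auto simp: k_def)
  then have ball: "ball 0 (1 / 2) \<subseteq> f ` unit_disc" by (simp add: k_def)
  \<comment> \<open>An empty frontier would give \<open>infdist\<close> its default value 0. If the
    image were the plane, the inverse of \<open>f\<close> would be a bounded entire function,
    contradicting Liouville's theorem.\<close>
  have "f ` unit_disc \<noteq> UNIV"
  proof
    assume UNIV: "f ` unit_disc = UNIV"
    obtain h where h: "h holomorphic_on f ` unit_disc" "\<And>z. z \<in> unit_disc \<Longrightarrow> h (f z) = z"
      using holomorphic_has_inverse[OF fh(1) open_ball inj] by metis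
    have "range h \<subseteq> unit_disc" using h(2) UNIV by (metis image_eqI image_subsetI imageE UNIV_I)
    then have "bounded (range h)" using bounded_ball bounded_subset by blast
    then have "h constant_on UNIV" using Liouville_theorem h(1) UNIV by metis
    then have "h (f 0) = h (f (1 / 2))" by (auto simp: constant_on_def)
    then show False using h(2)[of 0] h(2)[of "1 / 2"] by (simp add: norm_divide)
  qed
  then have ne: "frontier (f ` unit_disc) \<noteq> {}"
    by (auto simp: frontier_eq_empty)
  have "1 / 2 \<le> dist (f 0) y" if "y \<in> frontier (f ` unit_disc)" for y
  proof -
    have "y \<notin> f ` unit_disc" using that op by (simp add: frontier_def interior_open)
    then show ?thesis using ball fh(2) by (force simp: dist_norm)
  qed
  then show ?thesis
    unfolding infdist_notempty[OF ne] by (intro cINF_greatest ne)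
qed

section \<open>The Bohr radius and the extremal function\<close>

text \<open>The bound on the left-hand side of the Bohr inequality at \<open>cmod z = r\<close> when
  all Taylor coefficients have modulus at most 1; \<open>half_plane_map\<close> attains it on the
  positive radius.\<close>

definition bohr_majorant :: "nat \<Rightarrow> real \<Rightarrow> real" where
  "bohr_majorant N r = (r / (1 - r))\<^sup>2 + r ^ N / (1 - r)"

lemma radius_root_iff: "radius_root N r \<longleftrightarrow> 0 < r \<and> r < 1 \<and> bohr_majorant N r = 1 / 2"
proof -
  have "bohr_majorant N r = 1 / 2 \<longleftrightarrow> 1 - 2 * r - r\<^sup>2 - 2 * r ^ N + 2 * r ^ (1 + N) = 0" if "r < 1"
  proof -
    have eq: "bohr_majorant N r - 1 / 2 = - (1 - 2 * r - r\<^sup>2 - 2 * r ^ N + 2 * r ^ (1 + N)) / (2 * (1 - r)\<^sup>2)"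
      using that unfolding bohr_majorant_def
      by (simp add: divide_simps) (simp add: power2_eq_square algebra_simps)
    have "bohr_majorant N r = 1 / 2 \<longleftrightarrow> bohr_majorant N r - 1 / 2 = 0" by simp
    then show ?thesis
      unfolding eq divide_eq_0_iff neg_equal_0_iff_equal using that by simp
  qed
  then show ?thesis by (auto simp: radius_root_def)
qed

lemma bohr_majorant_strict_mono:
  assumes "0 \<le> x" "x < y" "y < 1"
  shows "bohr_majorant N x < bohr_majorant N y"
proof -
  have "x / (1 - x) < y / (1 - y)" using assms by (simp add: divide_simps) (simp add: algebra_simps)
  then have "(x / (1 - x))\<^sup>2 < (y / (1 - y))\<^sup>2" using assms by (intro power_strict_mono) auto
  moreover have "x ^ N / (1 - x) \<le> y ^ N / (1 - y)"
    using assms by (intro frac_le power_mono) auto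
  ultimately show ?thesis by (simp add: bohr_majorant_def)
qed

text \<open>Existence uses the polynomial, which is continuous up to 1 where the majorant has a
  pole. Uniqueness uses the strict monotonicity of the majorant.\<close>

lemma ex1_radius_root:
  assumes "N \<ge> 2"
  shows "\<exists>!r. radius_root N r"
proof -
  let ?P = "\<lambda>r::real. 1 - 2 * r - r\<^sup>2 - 2 * r ^ N + 2 * r ^ (1 + N)"
  have "?P 0 = 1" "?P 1 = - 2" using assms by simp_all
  moreover have "continuous_on {0..1} ?P" by (intro continuous_intros)
  ultimately have "\<exists>r\<ge>0. r \<le> 1 \<and> ?P r = 0"
    using assms by (intro IVT2') (simp_all add: power_0_left)
  then obtain r where r: "0 \<le> r" "r \<le> 1" "?P r = 0" by blast
  then have "r \<noteq> 0" "r \<noteq> 1" using assms by (auto simp: power_0_left)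
  then have "radius_root N r" using r by (simp add: radius_root_def)
  moreover have "s = t" if "radius_root N s" "radius_root N t" for s t
    using that bohr_majorant_strict_mono[of s t N] bohr_majorant_strict_mono[of t s N]
    unfolding radius_root_iff by (cases s t rule: linorder_cases) auto
  ultimately show ?thesis by blast
qed

lemma has_sum_power_atLeast:
  fixes x :: real
  assumes "0 \<le> x" "x < 1"
  shows "((\<lambda>n. x ^ n) has_sum x ^ N / (1 - x)) {N..}"
proof -
  have *: "(\<lambda>k. x ^ (k + N)) sums (x ^ N / (1 - x))"
    using sums_mult[OF geometric_sums[of x], of "x ^ N"] assms by (simp add: power_add mult_ac)
  then have "((\<lambda>k. x ^ (k + N)) has_sum x ^ N / (1 - x)) UNIV"
    using assms by (intro norm_summable_imp_has_sum) (auto simp: sums_iff)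
  then have "((\<lambda>n. x ^ n) \<circ> (\<lambda>k. k + N) has_sum x ^ N / (1 - x)) UNIV"
    by (simp add: o_def)
  then have "((\<lambda>n. x ^ n) has_sum x ^ N / (1 - x)) ((\<lambda>k. k + N) ` UNIV)"
    by (subst has_sum_reindex) (auto simp: inj_on_def)
  also have "(\<lambda>k. k + N) ` UNIV = {N..}"
    by (auto simp: image_iff) (metis le_add_diff_inverse2)
  finally show ?thesis .
qed

lemma class_C2_bohr_ineq:
  assumes f: "f \<in> class_C2" and z: "z \<in> unit_disc" and le: "bohr_majorant N (cmod z) \<le> 1 / 2"
  shows "bohr_ineq N f z"
proof -
  let ?r = "cmod z"
  have r: "0 \<le> ?r" "?r < 1" using z by auto
  have fh: "f holomorphic_on unit_disc" "f 0 = 0" using f by (auto simp: class_C2_def)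
  have "cmod (f z - f 0) \<le> 1 * ?r / (1 - ?r)"
    by (rule norm_le_geometric[OF fh(1) class_C2_coeff_bound[OF f] z])
  then have 1: "(cmod (f z))\<^sup>2 \<le> (?r / (1 - ?r))\<^sup>2"
    using fh(2) by (intro power_mono) auto
  note geo = has_sum_power_atLeast[OF r, of N]
  have term_le: "cmod (taylor_coeff f n * z ^ n) \<le> ?r ^ n" for n
    using class_C2_coeff_bound[OF f, of n] by (simp add: norm_mult norm_power mult_left_le_one_le)
  have "(\<lambda>n. cmod (taylor_coeff f n * z ^ n)) summable_on {N..}"
    by (rule summable_on_comparison_test[OF has_sum_imp_summable[OF geo]]) (use term_le in auto)
  then have "(\<Sum>\<^sub>\<infinity>n\<in>{N..}. cmod (taylor_coeff f n * z ^ n)) \<le> (\<Sum>\<^sub>\<infinity>n\<in>{N..}. ?r ^ n)"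
    by (rule infsum_mono[OF _ has_sum_imp_summable[OF geo]]) (rule term_le)
  also have "\<dots> = ?r ^ N / (1 - ?r)" by (rule infsumI[OF geo])
  finally have "(cmod (f z))\<^sup>2 + (\<Sum>\<^sub>\<infinity>n\<in>{N..}. cmod (taylor_coeff f n * z ^ n)) \<le> bohr_majorant N ?r"
    using 1 by (simp add: bohr_majorant_def)
  then show ?thesis
    using le class_C2_half_le_infdist[OF f] by (simp add: bohr_ineq_def)
qed

section \<open>The extremal function\<close>

definition half_plane_map :: "complex \<Rightarrow> complex" where
  "half_plane_map z = z / (1 - z)"

lemma unit_disc_neq_1: "z \<in> unit_disc \<Longrightarrow> 1 - z \<noteq> 0"
  by (metis eq_iff_diff_eq_0 less_irrefl mem_ball_0 norm_one)

lemma half_plane_map_holomorphic: "half_plane_map holomorphic_on unit_disc"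
  unfolding half_plane_map_def[abs_def] by (intro holomorphic_on_divide holomorphic_intros) (rule unit_disc_neq_1)

lemma half_plane_map_has_derivative:
  assumes "z \<noteq> 1"
  shows "(half_plane_map has_field_derivative 1 / (1 - z)\<^sup>2) (at z)"
proof -
  have "1 - z \<noteq> 0" using assms by simp
  then have "(half_plane_map has_field_derivative (1 * (1 - z) - z * (0 - 1)) / ((1 - z) * (1 - z))) (at z)"
    unfolding half_plane_map_def[abs_def]
    by (intro DERIV_divide DERIV_ident DERIV_diff DERIV_const)
  then show ?thesis by (simp add: power2_eq_square)
qed

text \<open>The inverse is \<open>w / (1 + w)\<close>, so the image consists of the points closer to
  0 than to -1.\<close>

lemma half_plane_map_image: "half_plane_map ` unit_disc = {w. Re w > - 1 / 2}"
proof -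
  have iff: "Re w > - 1 / 2 \<longleftrightarrow> cmod w < cmod (1 + w)" for w
  proof -
    have "(cmod (1 + w))\<^sup>2 - (cmod w)\<^sup>2 = 1 + 2 * Re w"
      unfolding cmod_power2 by (simp add: power2_eq_square algebra_simps)
    then have "Re w > - 1 / 2 \<longleftrightarrow> (cmod w)\<^sup>2 < (cmod (1 + w))\<^sup>2" by auto
    also have "\<dots> \<longleftrightarrow> cmod w < cmod (1 + w)"
      by (meson norm_ge_zero power_less_imp_less_base power_strict_mono zero_less_numeral)
    finally show ?thesis .
  qed
  show ?thesis
  proof (intro equalityI subsetI)
    fix w assume "w \<in> half_plane_map ` unit_disc"
    then obtain z where z: "z \<in> unit_disc" "w = z / (1 - z)" by (auto simp: half_plane_map_def)
    have nz: "1 - z \<noteq> 0" by (rule unit_disc_neq_1[OF z(1)])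
    have "1 + w = 1 / (1 - z)" using nz z(2) by (simp add: field_simps)
    then have "cmod w < cmod (1 + w)"
      using z nz by (simp add: norm_divide divide_strict_right_mono)
    then show "w \<in> {w. Re w > - 1 / 2}" by (simp add: iff[symmetric])
  next
    fix w assume "w \<in> {w. Re w > - 1 / 2}"
    then have w: "cmod w < cmod (1 + w)" using iff by simp
    then have nz: "1 + w \<noteq> 0" by auto
    then have "w = half_plane_map (w / (1 + w))"
      by (simp add: half_plane_map_def field_simps)
    moreover have "w / (1 + w) \<in> unit_disc" using w nz by (simp add: norm_divide)
    ultimately show "w \<in> half_plane_map ` unit_disc" by blast
  qed
qed

text \<open>The map serves as its own convex function \<open>g\<close>. The quotient is
  \<open>(1 + z) / (1 - z) = 1 + 2 * half_plane_map z\<close>, whose real part is positive by the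
  description of the image.\<close>

lemma half_plane_map_in_class_C2: "half_plane_map \<in> class_C2"
proof -
  have d: "deriv half_plane_map z = 1 / (1 - z)\<^sup>2" if "z \<noteq> 1" for z
    using DERIV_imp_deriv[OF half_plane_map_has_derivative[OF that]] .
  have "inj_on half_plane_map unit_disc"
  proof (rule inj_onI)
    fix x y assume "x \<in> unit_disc" "y \<in> unit_disc" "half_plane_map x = half_plane_map y"
    then show "x = y"
      using unit_disc_neq_1[of x] unit_disc_neq_1[of y]
      by (simp add: half_plane_map_def frac_eq_eq) (simp add: algebra_simps)
  qed
  moreover have "convex (half_plane_map ` unit_disc)"
    unfolding half_plane_map_image by (rule convex_halfspace_Re_gt)
  ultimately have cv: "convex_function half_plane_map"
    using half_plane_map_holomorphic by (simp add: convex_function_def)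
  have pos: "Re (deriv (\<lambda>w. w * deriv half_plane_map w) z / deriv half_plane_map z) > 0"
    if z: "z \<in> unit_disc" for z
  proof -
    have nz: "1 - z \<noteq> 0" by (rule unit_disc_neq_1[OF z])
    have "((\<lambda>w. w / (1 - w)\<^sup>2) has_field_derivative
        (1 * (1 - z)\<^sup>2 - z * (2 * (1 - z) * (- 1))) / ((1 - z)\<^sup>2 * (1 - z)\<^sup>2)) (at z)"
      using nz by (auto intro!: derivative_eq_intros)
    also have "1 * (1 - z)\<^sup>2 - z * (2 * (1 - z) * (- 1)) = (1 - z) * (1 + z)"
      by (simp add: power2_eq_square algebra_simps)
    also have "(1 - z) * (1 + z) / ((1 - z)\<^sup>2 * (1 - z)\<^sup>2) = (1 + z) / (1 - z) * (1 / (1 - z)\<^sup>2)"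
      using nz by (simp add: power2_eq_square)
    finally have "((\<lambda>w. w * deriv half_plane_map w) has_field_derivative
        (1 + z) / (1 - z) * (1 / (1 - z)\<^sup>2)) (at z)"
      by (rule has_field_derivative_transform_within_open[OF _ open_ball z])
         (subst d, auto)
    then have "deriv (\<lambda>w. w * deriv half_plane_map w) z / deriv half_plane_map z = (1 + z) / (1 - z)"
      using nz by (simp add: DERIV_imp_deriv d)
    also have "\<dots> = 1 + 2 * half_plane_map z"
      using nz by (simp add: half_plane_map_def field_simps)
    finally have "Re (deriv (\<lambda>w. w * deriv half_plane_map w) z / deriv half_plane_map z)
        = 1 + 2 * Re (half_plane_map z)" by simp
    moreover have "half_plane_map z \<in> {w. Re w > - 1 / 2}"
      unfolding half_plane_map_image[symmetric] using z by blast
    ultimately show ?thesis by simp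
  qed
  show ?thesis
    unfolding class_C2_def mem_Collect_eq
  proof (intro conjI exI[of _ half_plane_map] ballI)
    show "half_plane_map 0 = 0" "half_plane_map 0 = 0" by (simp_all add: half_plane_map_def)
    show "deriv half_plane_map 0 = 1" "Re (deriv half_plane_map 0) > 0" by (simp_all add: d)
  qed (fact half_plane_map_holomorphic cv pos)+
qed

lemma half_plane_map_coeff:
  assumes "n \<ge> 1"
  shows "taylor_coeff half_plane_map n = 1"
proof -
  let ?F = "Abs_fps (\<lambda>n. if n = 0 then 0 else 1 :: complex)"
  have "(\<lambda>n. fps_nth ?F n * u ^ n) sums half_plane_map u" if u: "u \<in> unit_disc" for u
  proof -
    have "(\<lambda>n. u * u ^ n) sums (u * (1 / (1 - u)))"
      using u by (intro sums_mult geometric_sums) simp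
    then have "(\<lambda>n. fps_nth ?F (Suc n) * u ^ Suc n) sums half_plane_map u"
      by (simp add: half_plane_map_def)
    then show ?thesis by (subst (asm) sums_Suc_iff) simp
  qed
  moreover have "\<forall>\<^sub>F u :: complex in nhds 0. u \<in> unit_disc"
    by (rule eventually_nhds_in_open) auto
  ultimately have "\<forall>\<^sub>F u in nhds 0. (\<lambda>n. fps_nth ?F n * u ^ n) sums half_plane_map u"
    by (rule eventually_mono[rotated])
  then have "half_plane_map has_fps_expansion ?F"
    by (rule has_fps_expansionI)
  then have "?F = Abs_fps (taylor_coeff half_plane_map)"
    using has_fps_expansion_unit_disc[OF half_plane_map_holomorphic] by (rule fps_expansion_unique_complex)
  then have "fps_nth ?F n = fps_nth (Abs_fps (taylor_coeff half_plane_map)) n" by (rule arg_cong)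
  then show ?thesis using assms by simp
qed

lemma half_plane_map_infdist_le:
  "infdist (half_plane_map 0) (frontier (half_plane_map ` unit_disc)) \<le> 1 / 2"
proof -
  have "frontier (half_plane_map ` unit_disc) = {w. Re w = - 1 / 2}"
    using frontier_halfspace_gt[of "1 :: complex" "- 1 / 2"]
    by (simp add: half_plane_map_image inner_complex_def)
  then have "infdist (half_plane_map 0) (frontier (half_plane_map ` unit_disc))
      \<le> dist (half_plane_map 0) (- 1 / 2)"
    by (intro infdist_le) simp
  then show ?thesis by (simp add: half_plane_map_def dist_norm norm_divide)
qed

lemma half_plane_map_not_bohr_ineq:
  assumes N: "N \<ge> 1" and x: "0 \<le> x" "x < 1" and gt: "bohr_majorant N x > 1 / 2"
  shows "\<not> bohr_ineq N half_plane_map (of_real x)"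
proof -
  have "(\<Sum>\<^sub>\<infinity>n\<in>{N..}. cmod (taylor_coeff half_plane_map n * of_real x ^ n)) = (\<Sum>\<^sub>\<infinity>n\<in>{N..}. x ^ n)"
    using N x by (intro infsum_cong) (simp add: half_plane_map_coeff norm_power)
  also have "\<dots> = x ^ N / (1 - x)" by (rule infsumI[OF has_sum_power_atLeast[OF x]])
  finally have "(\<Sum>\<^sub>\<infinity>n\<in>{N..}. cmod (taylor_coeff half_plane_map n * of_real x ^ n)) = x ^ N / (1 - x)" .
  moreover have "half_plane_map (of_real x) = of_real (x / (1 - x))"
    by (simp add: half_plane_map_def)
  then have "cmod (half_plane_map (of_real x)) = x / (1 - x)"
    using x by (simp only: norm_of_real) simp
  ultimately have "(cmod (half_plane_map (of_real x)))\<^sup>2 +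
      (\<Sum>\<^sub>\<infinity>n\<in>{N..}. cmod (taylor_coeff half_plane_map n * of_real x ^ n)) = bohr_majorant N x"
    by (simp add: bohr_majorant_def)
  then show ?thesis
    unfolding bohr_ineq_def using gt half_plane_map_infdist_le by linarith
qed

theorem theorem3p6:
  fixes N :: nat
  assumes "N \<ge> 2"
  shows "(\<exists>!r. radius_root N r) \<and>
    (\<forall>r. radius_root N r \<longrightarrow>
       (\<forall>f\<in>class_C2. \<forall>z. cmod z \<le> r \<longrightarrow> bohr_ineq N f z) \<and>
       (\<forall>R>r. \<exists>f\<in>class_C2. \<exists>z\<in>unit_disc. cmod z \<le> R \<and> \<not> bohr_ineq N f z))"
proof (intro conjI allI impI ballI ex1_radius_root[OF assms])
  fix r f z assume r: "radius_root N r" and f: "f \<in> class_C2" and z: "cmod z \<le> r"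
  have "bohr_majorant N (cmod z) \<le> 1 / 2"
    using r z bohr_majorant_strict_mono[of "cmod z" r N]
    by (cases "cmod z = r") (auto simp: radius_root_iff)
  then show "bohr_ineq N f z"
    using f r z by (intro class_C2_bohr_ineq) (auto simp: radius_root_def)
next
  fix r R assume r: "radius_root N r" and R: "r < R"
  \<comment> \<open>The witness has to lie in the disc even if \<open>R \<ge> 1\<close>, hence the
    cap at the midpoint of \<open>r\<close> and 1.\<close>
  define x where "x = min R ((1 + r) / 2)"
  have x: "r < x" "x < 1" "0 \<le> x" "x \<le> R"
    using r R by (auto simp: x_def radius_root_def min_def)
  have "bohr_majorant N x > 1 / 2"
    using r x bohr_majorant_strict_mono[of r x N] by (auto simp: radius_root_iff)
  then have "\<not> bohr_ineq N half_plane_map (of_real x)"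
    using assms x by (intro half_plane_map_not_bohr_ineq) auto
  then show "\<exists>f\<in>class_C2. \<exists>z\<in>unit_disc. cmod z \<le> R \<and> \<not> bohr_ineq N f z"
    using half_plane_map_in_class_C2 x
    by (intro bexI[of _ half_plane_map] bexI[of _ "of_real x"]) auto
qed

end
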